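(* Let $\Sigma=(B,K,E,\mathrm{ar},\mathrm{car})$ be a $\lambda_c$-signature and $\mathcal{A}=(\mathbb{C},T,A,a)$ a $\lambda_c(\Sigma)$-structure. Let $U$ be a strong monad on $\mathbb{C}$ and $\alpha\colon T\Rightarrow U$ a strong monad morphism. Let $\tau^T\colon T(\Omega^T)\to\Omega^T$ and $\tau^U\colon U(\Omega^U)\to\Omega^U$ be Eilenberg–Moore algebras and let $q\colon\Omega^T\to\Omega^U$ be an inference query for $\alpha,\tau^T,\tau^U$. Let $\Gamma\vdash M\colon\mathbf{t}$ be a well-typed term such that all types in $\Gamma$ and $\mathbf{t}$ are ground types, and let $Q\colon[\![\mathbf{t}]\!]\to\Omega^T$ be a morphism (a post-condition). Then $$q\circ \mathrm{wp}^{\mathcal{A}}_{\tau^T}[M](Q)=\mathrm{wp}^{\alpha(\mathcal{A})}_{\tau^U}[M](q\circ Q)$$ as morphisms $[\![\Gamma]\!]\to\Omega^U$.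
   Context: Standing conventions: $\mathbb{C}$ is a bicartesian closed category (bi-CCC) which is stable (binary coproducts are stable under pullback). $\mathrm{ev}_{X,Y}\colon X^Y\times Y\to X$ is evaluation and $(\cdot)^\dagger$ denotes transposition (currying/uncurrying) along $(-\times Y)\dashv(-)^Y$. A strong monad $(T,\eta^T,\mu^T,\mathrm{st}^T)$ has left strength $\mathrm{st}^T_{X,W}\colon X\times TW\to T(X\times W)$ and induced right strength $\mathrm{st}'^T_{W,X}\colon TW\times X\to T(W\times X)$. Syntax: given a set $B$ of base types, types are $\mathbf{t}::=b\mid\mathbf{1}\mid\mathbf{t}_1\times\mathbf{t}_2\mid\mathbf{0}\mid\mathbf{t}_1+\mathbf{t}_2\mid\mathbf{t}_1\to\mathbf{t}_2$ ($b\in B$); ground types are those not containing $\to$. A $\lambda_c$-signature $\Sigma=(B,K,E,\mathrm{ar},\mathrm{car})$ consists of $B$, a set $K$ of effect-free constants, a set $E$ of generic effects, and maps $\mathrm{ar},\mathrm{car}\colon K+E\to$ ground types. Terms: $M,N::=x\mid c\,M\mid e\,M\mid()\mid(M,N)\mid\pi_iM\mid\delta(M)\mid\iota_iM\mid\delta(M,x_1\colon\mathbf{t}_1.N_1,x_2\colon\mathbf{t}_2.N_2)\mid\lambda x\colon\mathbf{t}.M\mid M\,N$, typed by the standard rules of the simply typed call-by-value $\lambda$-calculus with products and sums, where $c\,M\colon\mathrm{car}(c)$ if $M\colon\mathrm{ar}(c)$, $e\,M\colon\mathrm{car}(e)$ if $M\colon\mathrm{ar}(e)$, and $\delta(M)\colon\mathbf{t}$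 (any $\mathbf{t}$) if $M\colon\mathbf{0}$. A $\lambda_c(\Sigma)$-structure $\mathcal{A}=(\mathbb{C},T,A,a)$ consists of $\mathbb{C}$, a strong monad $T$ on $\mathbb{C}$, an object $A(b)$ for each $b\in B$, and an assignment $a$ with $a(c)\colon[\![\mathrm{ar}(c)]\!]\to[\![\mathrm{car}(c)]\!]$ for $c\in K$ and $a(e)\colon[\![\mathrm{ar}(e)]\!]\to T[\![\mathrm{car}(e)]\!]$ for $e\in E$. Types are interpreted by $[\![b]\!]=A(b)$, $\mathbf{1},\times,\mathbf{0},+$ by the bi-CCC structure, and $[\![\mathbf{t}_1\to\mathbf{t}_2]\!]=T([\![\mathbf{t}_2]\!])^{[\![\mathbf{t}_1]\!]}$; contexts by $[\![x_1\colon\mathbf{t}_1,\dots,x_n\colon\mathbf{t}_n]\!]=\prod_i[\![\mathbf{t}_i]\!]$. (On ground types the interpretation does not depend on the monad.) A well-typed term $\Gamma\vdash M\colon\mathbf{t}$ is interpreted as $[\![M]\!]^{\mathcal{A}}\colon[\![\Gamma]\!]\to T[\![\mathbf{t}]\!]$ by Moggi's standard call-by-value monadic semantics: $[\![x_i]\!]=\eta\circ\pi_i$; $[\![()]\!]=\eta\circ{!}$; $[\![c\,M]\!]=T(a(c))\circ[\![M]\!]$; $[\![e\,M]\!]=\mu\circ T(a(e))\circ[\![M]\!]$; $[\![(M,N)]\!]=\mu\circ T(\mathrm{st})\circ\mathrm{st}'\circ\langle[\![M]\!],[\![N]\!]\rangle$; $[\![\pi_iM]\!]=T(\pi_i)\circ[\![M]\!]$;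 $[\![\iota_iM]\!]=T(\iota_i)\circ[\![M]\!]$; $[\![\delta(M)]\!]=T(!)\circ[\![M]\!]$; $[\![\delta(M,x_1.N_1,x_2.N_2)]\!]=\mu\circ T([[\![N_1]\!],[\![N_2]\!]]\circ\mathrm{dist})\circ\mathrm{st}\circ\langle\mathrm{id},[\![M]\!]\rangle$ with $\mathrm{dist}$ the distributivity isomorphism; $[\![\lambda x.M]\!]=\eta\circ[\![M]\!]^\dagger$; $[\![M\,N]\!]=\mu\circ T(\mu)\circ T^2(\mathrm{ev})\circ T(\mathrm{st})\circ\mathrm{st}'\circ\langle[\![M]\!],[\![N]\!]\rangle$. Weakest pre-condition: for an Eilenberg–Moore algebra $\tau\colon T\Omega\to\Omega$, a well-typed $\Gamma\vdash M\colon\mathbf{t}$ and $Q\colon[\![\mathbf{t}]\!]\to\Omega$, $\mathrm{wp}^{\mathcal{A}}_{\tau}[M](Q):=\tau\circ T(Q)\circ[\![M]\!]^{\mathcal{A}}\colon[\![\Gamma]\!]\to\Omega$. A strong monad morphism $\alpha\colon T\Rightarrow U$ is a natural transformation with $\alpha\circ\eta^T=\eta^U$, $\alpha\circ\mu^T=\mu^U\circ U(\alpha)\circ\alpha_T$, and $\alpha_{X\times Y}\circ\mathrm{st}^T=\mathrm{st}^U\circ(\mathrm{id}_X\times\alpha_Y)$. Given such $\alpha$, $\alpha(\mathcal{A})$ is the $\lambda_c(\Sigma)$-structure $(\mathbb{C},U,A,\alpha(a))$ with $\alpha(a)(c)=a(c)$ and $\alpha(a)(e)=\alpha_{[\![\mathrm{car}(e)]\!]}\circ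 a(e)$. An inference query for $\alpha,\tau^T,\tau^U$ is a morphism $q\colon\Omega^T\to\Omega^U$ with $q\circ\tau^T=\tau^U\circ U(q)\circ\alpha_{\Omega^T}$. *)

theory Defs
  imports Main
begin

section \<open>Categories\<close>

record ('o, 'm) category =
  Obj :: "'o set"
  Arr :: "'m set"
  Dom :: "'m \<Rightarrow> 'o"
  Cod :: "'m \<Rightarrow> 'o"
  Id  :: "'o \<Rightarrow> 'm"
  Comp :: "'m \<Rightarrow> 'm \<Rightarrow> 'm"  (infixr "\<cdot>\<index>" 70)

definition hom :: "('o, 'm, 'z) category_scheme \<Rightarrow> 'o \<Rightarrow> 'o \<Rightarrow> 'm set" where
  "hom C X Y = {f \<in> Arr C. Dom C f = X \<and> Cod C f = Y}"

locale category =
  fixes C :: "('o, 'm, 'z) category_scheme" (structure)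
  assumes dom_obj: "f \<in> Arr C \<Longrightarrow> Dom C f \<in> Obj C"
    and cod_obj: "f \<in> Arr C \<Longrightarrow> Cod C f \<in> Obj C"
    and id_hom: "X \<in> Obj C \<Longrightarrow> Id C X \<in> hom C X X"
    and comp_hom: "\<lbrakk>f \<in> hom C X Y; g \<in> hom C Y Z\<rbrakk> \<Longrightarrow> g \<cdot> f \<in> hom C X Z"
    and comp_assoc: "\<lbrakk>f \<in> hom C X Y; g \<in> hom C Y Z; h \<in> hom C Z W\<rbrakk>
                       \<Longrightarrow> (h \<cdot> g) \<cdot> f = h \<cdot> (g \<cdot> f)"
    and id_left: "f \<in> hom C X Y \<Longrightarrow> Id C Y \<cdot> f = f"
    and id_right: "f \<in> hom C X Y \<Longrightarrow> f \<cdot> Id C X = f"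

definition is_terminal :: "('o, 'm, 'z) category_scheme \<Rightarrow> 'o \<Rightarrow> bool" where
  "is_terminal C X \<longleftrightarrow> X \<in> Obj C \<and> (\<forall>Z\<in>Obj C. \<exists>!f. f \<in> hom C Z X)"

definition is_initial :: "('o, 'm, 'z) category_scheme \<Rightarrow> 'o \<Rightarrow> bool" where
  "is_initial C X \<longleftrightarrow> X \<in> Obj C \<and> (\<forall>Z\<in>Obj C. \<exists>!f. f \<in> hom C X Z)"

definition is_product ::
  "('o, 'm, 'z) category_scheme \<Rightarrow> 'o \<Rightarrow> 'o \<Rightarrow> 'o \<Rightarrow> 'm \<Rightarrow> 'm \<Rightarrow> bool" where
  "is_product C X Y P p1 p2 \<longleftrightarrow>
     P \<in> Obj C \<and> p1 \<in> hom C P X \<and> p2 \<in> hom C P Y \<and>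
     (\<forall>Z\<in>Obj C. \<forall>f\<in>hom C Z X. \<forall>g\<in>hom C Z Y.
        \<exists>!h. h \<in> hom C Z P \<and> p1 \<cdot>\<^bsub>C\<^esub> h = f \<and> p2 \<cdot>\<^bsub>C\<^esub> h = g)"

definition is_coproduct ::
  "('o, 'm, 'z) category_scheme \<Rightarrow> 'o \<Rightarrow> 'o \<Rightarrow> 'o \<Rightarrow> 'm \<Rightarrow> 'm \<Rightarrow> bool" where
  "is_coproduct C X Y S i1 i2 \<longleftrightarrow>
     S \<in> Obj C \<and> i1 \<in> hom C X S \<and> i2 \<in> hom C Y S \<and>
     (\<forall>Z\<in>Obj C. \<forall>f\<in>hom C X Z. \<forall>g\<in>hom C Y Z.
        \<exists>!h. h \<in> hom C S Z \<and> h \<cdot>\<^bsub>C\<^esub> i1 = f \<and> h \<cdot>\<^bsub>C\<^esub> i2 = g)"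

definition is_pullback ::
  "('o, 'm, 'z) category_scheme \<Rightarrow> 'm \<Rightarrow> 'm \<Rightarrow> 'o \<Rightarrow> 'm \<Rightarrow> 'm \<Rightarrow> bool" where
  "is_pullback C f g P p1 p2 \<longleftrightarrow>
     f \<in> Arr C \<and> g \<in> Arr C \<and> Cod C f = Cod C g \<and>
     P \<in> Obj C \<and> p1 \<in> hom C P (Dom C f) \<and> p2 \<in> hom C P (Dom C g) \<and>
     f \<cdot>\<^bsub>C\<^esub> p1 = g \<cdot>\<^bsub>C\<^esub> p2 \<and>
     (\<forall>Z\<in>Obj C. \<forall>u\<in>hom C Z (Dom C f). \<forall>v\<in>hom C Z (Dom C g).
        f \<cdot>\<^bsub>C\<^esub> u = g \<cdot>\<^bsub>C\<^esub> v \<longrightarrow>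
        (\<exists>!h. h \<in> hom C Z P \<and> p1 \<cdot>\<^bsub>C\<^esub> h = u \<and> p2 \<cdot>\<^bsub>C\<^esub> h = v))"


section \<open>Stable bicartesian closed categories\<close>

text \<open>\<open>Exp C X Y\<close> is the exponential \<open>X\<^sup>Y\<close>, and
  \<open>Ev C X Y\<close> the evaluation \<open>X\<^sup>Y \<times> Y \<rightarrow> X\<close>.\<close>

record ('o, 'm) biccc = "('o, 'm) category" +
  One  :: 'o
  Prod :: "'o \<Rightarrow> 'o \<Rightarrow> 'o"
  Pr1  :: "'o \<Rightarrow> 'o \<Rightarrow> 'm"
  Pr2  :: "'o \<Rightarrow> 'o \<Rightarrow> 'm"
  Zero :: 'o
  Sum  :: "'o \<Rightarrow> 'o \<Rightarrow> 'o"
  In1  :: "'o \<Rightarrow> 'o \<Rightarrow> 'm"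
  In2  :: "'o \<Rightarrow> 'o \<Rightarrow> 'm"
  Exp  :: "'o \<Rightarrow> 'o \<Rightarrow> 'o"
  Ev   :: "'o \<Rightarrow> 'o \<Rightarrow> 'm"

definition to_one :: "('o, 'm, 'z) biccc_scheme \<Rightarrow> 'o \<Rightarrow> 'm" where
  "to_one C X = (THE f. f \<in> hom C X (One C))"

definition from_zero :: "('o, 'm, 'z) biccc_scheme \<Rightarrow> 'o \<Rightarrow> 'm" where
  "from_zero C X = (THE f. f \<in> hom C (Zero C) X)"

definition tuple :: "('o, 'm, 'z) biccc_scheme \<Rightarrow> 'm \<Rightarrow> 'm \<Rightarrow> 'm" where
  "tuple C f g = (THE h. h \<in> hom C (Dom C f) (Prod C (Cod C f) (Cod C g)) \<and>
      Pr1 C (Cod C f) (Cod C g) \<cdot>\<^bsub>C\<^esub> h = f \<and> Pr2 C (Cod C f) (Cod C g) \<cdot>\<^bsub>C\<^esub> h = g)"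

definition cotuple :: "('o, 'm, 'z) biccc_scheme \<Rightarrow> 'm \<Rightarrow> 'm \<Rightarrow> 'm" where
  "cotuple C f g = (THE h. h \<in> hom C (Sum C (Dom C f) (Dom C g)) (Cod C f) \<and>
      h \<cdot>\<^bsub>C\<^esub> In1 C (Dom C f) (Dom C g) = f \<and> h \<cdot>\<^bsub>C\<^esub> In2 C (Dom C f) (Dom C g) = g)"

definition prod_map :: "('o, 'm, 'z) biccc_scheme \<Rightarrow> 'm \<Rightarrow> 'm \<Rightarrow> 'm" where
  "prod_map C f g = tuple C (f \<cdot>\<^bsub>C\<^esub> Pr1 C (Dom C f) (Dom C g)) (g \<cdot>\<^bsub>C\<^esub> Pr2 C (Dom C f) (Dom C g))"

text \<open>Transposition sends \<open>f : Z \<times> Y \<rightarrow> X\<close> to \<open>Z \<rightarrow> X\<^sup>Y\<close>.\<close>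

definition transpose :: "('o, 'm, 'z) biccc_scheme \<Rightarrow> 'o \<Rightarrow> 'o \<Rightarrow> 'm \<Rightarrow> 'm" where
  "transpose C Z Y f = (THE g. g \<in> hom C Z (Exp C (Cod C f) Y) \<and>
      Ev C (Cod C f) Y \<cdot>\<^bsub>C\<^esub> prod_map C g (Id C Y) = f)"

definition swap :: "('o, 'm, 'z) biccc_scheme \<Rightarrow> 'o \<Rightarrow> 'o \<Rightarrow> 'm" where
  "swap C X Y = tuple C (Pr2 C X Y) (Pr1 C X Y)"

text \<open>\<open>(X \<times> Y) \<times> W \<rightarrow> X \<times> (Y \<times> W)\<close>\<close>

definition assoc :: "('o, 'm, 'z) biccc_scheme \<Rightarrow> 'o \<Rightarrow> 'o \<Rightarrow> 'o \<Rightarrow> 'm" where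
  "assoc C X Y W = tuple C
     (Pr1 C X Y \<cdot>\<^bsub>C\<^esub> Pr1 C (Prod C X Y) W)
     (tuple C (Pr2 C X Y \<cdot>\<^bsub>C\<^esub> Pr1 C (Prod C X Y) W) (Pr2 C (Prod C X Y) W))"

text \<open>The distributivity isomorphism \<open>X \<times> (Y + Z) \<rightarrow> X \<times> Y + X \<times> Z\<close>, as the
  inverse of the canonical morphism.\<close>

definition dist :: "('o, 'm, 'z) biccc_scheme \<Rightarrow> 'o \<Rightarrow> 'o \<Rightarrow> 'o \<Rightarrow> 'm" where
  "dist C X Y Z =
    (let c = cotuple C (prod_map C (Id C X) (In1 C Y Z)) (prod_map C (Id C X) (In2 C Y Z));
         P = Prod C X (Sum C Y Z); S = Sum C (Prod C X Y) (Prod C X Z)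
     in THE d. d \<in> hom C P S \<and> d \<cdot>\<^bsub>C\<^esub> c = Id C S \<and> c \<cdot>\<^bsub>C\<^esub> d = Id C P)"

locale biccc = category C for C :: "('o, 'm, 'z) biccc_scheme" (structure) +
  assumes one_terminal: "is_terminal C (One C)"
    and zero_initial: "is_initial C (Zero C)"
    and prod_product: "\<lbrakk>X \<in> Obj C; Y \<in> Obj C\<rbrakk> \<Longrightarrow>
          is_product C X Y (Prod C X Y) (Pr1 C X Y) (Pr2 C X Y)"
    and sum_coproduct: "\<lbrakk>X \<in> Obj C; Y \<in> Obj C\<rbrakk> \<Longrightarrow>
          is_coproduct C X Y (Sum C X Y) (In1 C X Y) (In2 C X Y)"
    and exp_obj: "\<lbrakk>X \<in> Obj C; Y \<in> Obj C\<rbrakk> \<Longrightarrow> Exp C X Y \<in> Obj C"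
    and ev_hom: "\<lbrakk>X \<in> Obj C; Y \<in> Obj C\<rbrakk> \<Longrightarrow> Ev C X Y \<in> hom C (Prod C (Exp C X Y) Y) X"
    and exp_universal: "\<lbrakk>X \<in> Obj C; Y \<in> Obj C; Z \<in> Obj C; f \<in> hom C (Prod C Z Y) X\<rbrakk> \<Longrightarrow>
          \<exists>!g. g \<in> hom C Z (Exp C X Y) \<and> Ev C X Y \<cdot> prod_map C g (Id C Y) = f"

text \<open>Pullbacks need not exist in a bicartesian closed category. Stability says that whenever
  both pullbacks of the coprojections along a morphism exist, they form a coproduct diagram;
  the existence of these pullbacks is not assumed.\<close>

locale stable_biccc = biccc C for C :: "('o, 'm, 'z) biccc_scheme" (structure) +
  assumes coproduct_stable:
    "\<lbrakk>is_coproduct C X Y S i1 i2; f \<in> hom C Z S;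
      is_pullback C f i1 P1 p1 r1; is_pullback C f i2 P2 p2 r2\<rbrakk>
     \<Longrightarrow> is_coproduct C P1 P2 Z p1 p2"


section \<open>Strong monads, algebras and morphisms\<close>

text \<open>\<open>Strength T X W\<close> is the left strength \<open>X \<times> T W \<rightarrow> T (X \<times> W)\<close>.\<close>

record ('o, 'm) strong_monad =
  FObj :: "'o \<Rightarrow> 'o"
  FMap :: "'m \<Rightarrow> 'm"
  Unit :: "'o \<Rightarrow> 'm"
  Mult :: "'o \<Rightarrow> 'm"
  Strength :: "'o \<Rightarrow> 'o \<Rightarrow> 'm"

locale strong_monad = biccc C
  for C :: "('o, 'm, 'z) biccc_scheme" (structure) and T :: "('o, 'm) strong_monad" +
  assumes fobj: "X \<in> Obj C \<Longrightarrow> FObj T X \<in> Obj C"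
    and fmap_hom: "f \<in> hom C X Y \<Longrightarrow> FMap T f \<in> hom C (FObj T X) (FObj T Y)"
    and fmap_id: "X \<in> Obj C \<Longrightarrow> FMap T (Id C X) = Id C (FObj T X)"
    and fmap_comp: "\<lbrakk>f \<in> hom C X Y; g \<in> hom C Y Z\<rbrakk> \<Longrightarrow> FMap T (g \<cdot> f) = FMap T g \<cdot> FMap T f"
    and unit_hom: "X \<in> Obj C \<Longrightarrow> Unit T X \<in> hom C X (FObj T X)"
    and unit_natural: "f \<in> hom C X Y \<Longrightarrow> FMap T f \<cdot> Unit T X = Unit T Y \<cdot> f"
    and mult_hom: "X \<in> Obj C \<Longrightarrow> Mult T X \<in> hom C (FObj T (FObj T X)) (FObj T X)"
    and mult_natural: "f \<in> hom C X Y \<Longrightarrow> FMap T f \<cdot> Mult T X = Mult T Y \<cdot> FMap T (FMap T f)"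
    and mult_unit_left: "X \<in> Obj C \<Longrightarrow> Mult T X \<cdot> Unit T (FObj T X) = Id C (FObj T X)"
    and mult_unit_right: "X \<in> Obj C \<Longrightarrow> Mult T X \<cdot> FMap T (Unit T X) = Id C (FObj T X)"
    and mult_assoc: "X \<in> Obj C \<Longrightarrow> Mult T X \<cdot> Mult T (FObj T X) = Mult T X \<cdot> FMap T (Mult T X)"
    and strength_hom: "\<lbrakk>X \<in> Obj C; W \<in> Obj C\<rbrakk> \<Longrightarrow>
          Strength T X W \<in> hom C (Prod C X (FObj T W)) (FObj T (Prod C X W))"
    and strength_natural: "\<lbrakk>f \<in> hom C X X'; g \<in> hom C W W'\<rbrakk> \<Longrightarrow>
          Strength T X' W' \<cdot> prod_map C f (FMap T g) = FMap T (prod_map C f g) \<cdot> Strength T X W"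
    and strength_one: "W \<in> Obj C \<Longrightarrow>
          FMap T (Pr2 C (One C) W) \<cdot> Strength T (One C) W = Pr2 C (One C) (FObj T W)"
    and strength_assoc: "\<lbrakk>X \<in> Obj C; Y \<in> Obj C; W \<in> Obj C\<rbrakk> \<Longrightarrow>
          FMap T (assoc C X Y W) \<cdot> Strength T (Prod C X Y) W =
          Strength T X (Prod C Y W) \<cdot> prod_map C (Id C X) (Strength T Y W) \<cdot> assoc C X Y (FObj T W)"
    and strength_unit: "\<lbrakk>X \<in> Obj C; W \<in> Obj C\<rbrakk> \<Longrightarrow>
          Strength T X W \<cdot> prod_map C (Id C X) (Unit T W) = Unit T (Prod C X W)"
    and strength_mult: "\<lbrakk>X \<in> Obj C; W \<in> Obj C\<rbrakk> \<Longrightarrow>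
          Strength T X W \<cdot> prod_map C (Id C X) (Mult T W) =
          Mult T (Prod C X W) \<cdot> FMap T (Strength T X W) \<cdot> Strength T X (FObj T W)"

text \<open>The induced right strength \<open>T W \<times> X \<rightarrow> T (W \<times> X)\<close>.\<close>

definition right_strength ::
  "('o, 'm, 'z) biccc_scheme \<Rightarrow> ('o, 'm) strong_monad \<Rightarrow> 'o \<Rightarrow> 'o \<Rightarrow> 'm" where
  "right_strength C T W X =
     FMap T (swap C X W) \<cdot>\<^bsub>C\<^esub> Strength T X W \<cdot>\<^bsub>C\<^esub> swap C (FObj T W) X"

locale em_algebra = strong_monad C T
  for C :: "('o, 'm, 'z) biccc_scheme" (structure) and T :: "('o, 'm) strong_monad"
    and \<Omega> :: 'o and \<tau> :: 'm +
  assumes carrier_obj: "\<Omega> \<in> Obj C"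
    and action_hom: "\<tau> \<in> hom C (FObj T \<Omega>) \<Omega>"
    and action_unit: "\<tau> \<cdot> Unit T \<Omega> = Id C \<Omega>"
    and action_mult: "\<tau> \<cdot> Mult T \<Omega> = \<tau> \<cdot> FMap T \<tau>"

locale strong_monad_morphism = T: strong_monad C T + U: strong_monad C U
  for C :: "('o, 'm, 'z) biccc_scheme" (structure) and T U :: "('o, 'm) strong_monad"
    and \<alpha> :: "'o \<Rightarrow> 'm" +
  assumes component_hom: "X \<in> Obj C \<Longrightarrow> \<alpha> X \<in> hom C (FObj T X) (FObj U X)"
    and natural: "f \<in> hom C X Y \<Longrightarrow> \<alpha> Y \<cdot> FMap T f = FMap U f \<cdot> \<alpha> X"
    and preserves_unit: "X \<in> Obj C \<Longrightarrow> \<alpha> X \<cdot> Unit T X = Unit U X"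
    and preserves_mult: "X \<in> Obj C \<Longrightarrow>
          \<alpha> X \<cdot> Mult T X = Mult U X \<cdot> FMap U (\<alpha> X) \<cdot> \<alpha> (FObj T X)"
    and preserves_strength: "\<lbrakk>X \<in> Obj C; Y \<in> Obj C\<rbrakk> \<Longrightarrow>
          \<alpha> (Prod C X Y) \<cdot> Strength T X Y = Strength U X Y \<cdot> prod_map C (Id C X) (\<alpha> Y)"

definition inference_query ::
  "('o, 'm, 'z) biccc_scheme \<Rightarrow> ('o, 'm) strong_monad \<Rightarrow> ('o \<Rightarrow> 'm) \<Rightarrow>
   'o \<Rightarrow> 'm \<Rightarrow> 'o \<Rightarrow> 'm \<Rightarrow> 'm \<Rightarrow> bool" where
  "inference_query C U \<alpha> \<Omega>T \<tau>T \<Omega>U \<tau>U q \<longleftrightarrow>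
     q \<in> hom C \<Omega>T \<Omega>U \<and> q \<cdot>\<^bsub>C\<^esub> \<tau>T = \<tau>U \<cdot>\<^bsub>C\<^esub> FMap U q \<cdot>\<^bsub>C\<^esub> \<alpha> \<Omega>T"


section \<open>Syntax\<close>

datatype (base_types: 'b) ty =
    Base 'b
  | TOne
  | TProd "'b ty" "'b ty"
  | TZero
  | TSum "'b ty" "'b ty"
  | TFun "'b ty" "'b ty"

primrec ground :: "'b ty \<Rightarrow> bool" where
  "ground (Base b) = True"
| "ground TOne = True"
| "ground (TProd s t) = (ground s \<and> ground t)"
| "ground TZero = True"
| "ground (TSum s t) = (ground s \<and> ground t)"
| "ground (TFun s t) = False"

record ('b, 'k, 'e) signature =
  bases :: "'b set"
  consts_of :: "'k set"
  effects_of :: "'e set"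
  ar  :: "'k + 'e \<Rightarrow> 'b ty"
  car :: "'k + 'e \<Rightarrow> 'b ty"

definition types :: "('b, 'k, 'e) signature \<Rightarrow> 'b ty set" where
  "types \<Sigma> = {t. base_types t \<subseteq> bases \<Sigma>}"

definition ground_types :: "('b, 'k, 'e) signature \<Rightarrow> 'b ty set" where
  "ground_types \<Sigma> = {t \<in> types \<Sigma>. ground t}"

definition lc_signature :: "('b, 'k, 'e) signature \<Rightarrow> bool" where
  "lc_signature \<Sigma> \<longleftrightarrow>
     (\<forall>c \<in> consts_of \<Sigma> <+> effects_of \<Sigma>. ar \<Sigma> c \<in> ground_types \<Sigma> \<and> car \<Sigma> c \<in> ground_types \<Sigma>)"

datatype ('v, 'b, 'k, 'e) trm =
    Var 'v
  | Const 'k "('v, 'b, 'k, 'e) trm"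
  | Eff 'e "('v, 'b, 'k, 'e) trm"
  | Triv
  | Pair "('v, 'b, 'k, 'e) trm" "('v, 'b, 'k, 'e) trm"
  | Proj1 "('v, 'b, 'k, 'e) trm"
  | Proj2 "('v, 'b, 'k, 'e) trm"
  | Absurd "('v, 'b, 'k, 'e) trm"
  | Inj1 "('v, 'b, 'k, 'e) trm"
  | Inj2 "('v, 'b, 'k, 'e) trm"
  | Case "('v, 'b, 'k, 'e) trm" 'v "'b ty" "('v, 'b, 'k, 'e) trm" 'v "'b ty" "('v, 'b, 'k, 'e) trm"
  | Lam 'v "'b ty" "('v, 'b, 'k, 'e) trm"
  | App "('v, 'b, 'k, 'e) trm" "('v, 'b, 'k, 'e) trm"

text \<open>The context \<open>x1 : t1, \<dots>, xn : tn\<close> is the list \<open>[(xn, tn), \<dots>, (x1, t1)]\<close>: the variable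
  bound last comes first, and it shadows earlier ones of the same name.\<close>

type_synonym ('v, 'b) ctx = "('v \<times> 'b ty) list"

inductive typed ::
  "('b, 'k, 'e) signature \<Rightarrow> ('v, 'b) ctx \<Rightarrow> ('v, 'b, 'k, 'e) trm \<Rightarrow> 'b ty \<Rightarrow> bool"
  for \<Sigma> where
  "map_of \<Gamma> x = Some t \<Longrightarrow> typed \<Sigma> \<Gamma> (Var x) t"
| "\<lbrakk>c \<in> consts_of \<Sigma>; typed \<Sigma> \<Gamma> M (ar \<Sigma> (Inl c))\<rbrakk> \<Longrightarrow> typed \<Sigma> \<Gamma> (Const c M) (car \<Sigma> (Inl c))"
| "\<lbrakk>e \<in> effects_of \<Sigma>; typed \<Sigma> \<Gamma> M (ar \<Sigma> (Inr e))\<rbrakk> \<Longrightarrow> typed \<Sigma> \<Gamma> (Eff e M) (car \<Sigma> (Inr e))"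
| "typed \<Sigma> \<Gamma> Triv TOne"
| "\<lbrakk>typed \<Sigma> \<Gamma> M t1; typed \<Sigma> \<Gamma> N t2\<rbrakk> \<Longrightarrow> typed \<Sigma> \<Gamma> (Pair M N) (TProd t1 t2)"
| "typed \<Sigma> \<Gamma> M (TProd t1 t2) \<Longrightarrow> typed \<Sigma> \<Gamma> (Proj1 M) t1"
| "typed \<Sigma> \<Gamma> M (TProd t1 t2) \<Longrightarrow> typed \<Sigma> \<Gamma> (Proj2 M) t2"
| "\<lbrakk>t \<in> types \<Sigma>; typed \<Sigma> \<Gamma> M TZero\<rbrakk> \<Longrightarrow> typed \<Sigma> \<Gamma> (Absurd M) t"
| "\<lbrakk>t2 \<in> types \<Sigma>; typed \<Sigma> \<Gamma> M t1\<rbrakk> \<Longrightarrow> typed \<Sigma> \<Gamma> (Inj1 M) (TSum t1 t2)"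
| "\<lbrakk>t1 \<in> types \<Sigma>; typed \<Sigma> \<Gamma> M t2\<rbrakk> \<Longrightarrow> typed \<Sigma> \<Gamma> (Inj2 M) (TSum t1 t2)"
| "\<lbrakk>typed \<Sigma> \<Gamma> M (TSum t1 t2); typed \<Sigma> ((x1, t1) # \<Gamma>) N1 t; typed \<Sigma> ((x2, t2) # \<Gamma>) N2 t\<rbrakk>
     \<Longrightarrow> typed \<Sigma> \<Gamma> (Case M x1 t1 N1 x2 t2 N2) t"
| "\<lbrakk>t1 \<in> types \<Sigma>; typed \<Sigma> ((x, t1) # \<Gamma>) M t2\<rbrakk> \<Longrightarrow> typed \<Sigma> \<Gamma> (Lam x t1 M) (TFun t1 t2)"
| "\<lbrakk>typed \<Sigma> \<Gamma> M (TFun t1 t2); typed \<Sigma> \<Gamma> N t1\<rbrakk> \<Longrightarrow> typed \<Sigma> \<Gamma> (App M N) t2"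

text \<open>The terms \<open>\<delta>(M)\<close> and \<open>\<iota>\<^sub>i M\<close> carry no type annotation, so a judgement may have several
  typing derivations, which differ in the types of subterms; the interpretation of a well-typed
  term is a recursion over a derivation. Derivations are therefore first-class data: one
  constructor for each rule above, recording the types that instantiate the rule.
  \<open>derives \<Sigma> \<Gamma> D M t\<close> says that \<open>D\<close> is a derivation of \<open>\<Gamma> \<turnstile> M : t\<close>.\<close>

datatype ('v, 'b, 'k, 'e) deriv =
    VarD 'v
  | ConstD 'k "('v, 'b, 'k, 'e) deriv"
  | EffD 'e "('v, 'b, 'k, 'e) deriv"
  | TrivD
  | PairD "'b ty" "'b ty" "('v, 'b, 'k, 'e) deriv" "('v, 'b, 'k, 'e) deriv"
  | Proj1D "'b ty" "'b ty" "('v, 'b, 'k, 'e) deriv"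
  | Proj2D "'b ty" "'b ty" "('v, 'b, 'k, 'e) deriv"
  | AbsurdD "'b ty" "('v, 'b, 'k, 'e) deriv"
  | Inj1D "'b ty" "'b ty" "('v, 'b, 'k, 'e) deriv"
  | Inj2D "'b ty" "'b ty" "('v, 'b, 'k, 'e) deriv"
  | CaseD "'b ty" "('v, 'b, 'k, 'e) deriv"
      'v "'b ty" "('v, 'b, 'k, 'e) deriv" 'v "'b ty" "('v, 'b, 'k, 'e) deriv"
  | LamD 'v "'b ty" "'b ty" "('v, 'b, 'k, 'e) deriv"
  | AppD "'b ty" "'b ty" "('v, 'b, 'k, 'e) deriv" "('v, 'b, 'k, 'e) deriv"

inductive derives ::
  "('b, 'k, 'e) signature \<Rightarrow> ('v, 'b) ctx \<Rightarrow> ('v, 'b, 'k, 'e) deriv \<Rightarrow> ('v, 'b, 'k, 'e) trm \<Rightarrow>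
   'b ty \<Rightarrow> bool"
  for \<Sigma> where
  "map_of \<Gamma> x = Some t \<Longrightarrow> derives \<Sigma> \<Gamma> (VarD x) (Var x) t"
| "\<lbrakk>c \<in> consts_of \<Sigma>; derives \<Sigma> \<Gamma> D M (ar \<Sigma> (Inl c))\<rbrakk>
     \<Longrightarrow> derives \<Sigma> \<Gamma> (ConstD c D) (Const c M) (car \<Sigma> (Inl c))"
| "\<lbrakk>e \<in> effects_of \<Sigma>; derives \<Sigma> \<Gamma> D M (ar \<Sigma> (Inr e))\<rbrakk>
     \<Longrightarrow> derives \<Sigma> \<Gamma> (EffD e D) (Eff e M) (car \<Sigma> (Inr e))"
| "derives \<Sigma> \<Gamma> TrivD Triv TOne"
| "\<lbrakk>derives \<Sigma> \<Gamma> D M t1; derives \<Sigma> \<Gamma> E N t2\<rbrakk>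
     \<Longrightarrow> derives \<Sigma> \<Gamma> (PairD t1 t2 D E) (Pair M N) (TProd t1 t2)"
| "derives \<Sigma> \<Gamma> D M (TProd t1 t2) \<Longrightarrow> derives \<Sigma> \<Gamma> (Proj1D t1 t2 D) (Proj1 M) t1"
| "derives \<Sigma> \<Gamma> D M (TProd t1 t2) \<Longrightarrow> derives \<Sigma> \<Gamma> (Proj2D t1 t2 D) (Proj2 M) t2"
| "\<lbrakk>t \<in> types \<Sigma>; derives \<Sigma> \<Gamma> D M TZero\<rbrakk> \<Longrightarrow> derives \<Sigma> \<Gamma> (AbsurdD t D) (Absurd M) t"
| "\<lbrakk>t2 \<in> types \<Sigma>; derives \<Sigma> \<Gamma> D M t1\<rbrakk>
     \<Longrightarrow> derives \<Sigma> \<Gamma> (Inj1D t1 t2 D) (Inj1 M) (TSum t1 t2)"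
| "\<lbrakk>t1 \<in> types \<Sigma>; derives \<Sigma> \<Gamma> D M t2\<rbrakk>
     \<Longrightarrow> derives \<Sigma> \<Gamma> (Inj2D t1 t2 D) (Inj2 M) (TSum t1 t2)"
| "\<lbrakk>derives \<Sigma> \<Gamma> D M (TSum t1 t2);
    derives \<Sigma> ((x1, t1) # \<Gamma>) E1 N1 t; derives \<Sigma> ((x2, t2) # \<Gamma>) E2 N2 t\<rbrakk>
     \<Longrightarrow> derives \<Sigma> \<Gamma> (CaseD t D x1 t1 E1 x2 t2 E2) (Case M x1 t1 N1 x2 t2 N2) t"
| "\<lbrakk>t1 \<in> types \<Sigma>; derives \<Sigma> ((x, t1) # \<Gamma>) D M t2\<rbrakk>
     \<Longrightarrow> derives \<Sigma> \<Gamma> (LamD x t1 t2 D) (Lam x t1 M) (TFun t1 t2)"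
| "\<lbrakk>derives \<Sigma> \<Gamma> D M (TFun t1 t2); derives \<Sigma> \<Gamma> E N t1\<rbrakk>
     \<Longrightarrow> derives \<Sigma> \<Gamma> (AppD t1 t2 D E) (App M N) t2"

lemma typed_iff_derives: "typed \<Sigma> \<Gamma> M t \<longleftrightarrow> (\<exists>D. derives \<Sigma> \<Gamma> D M t)"
proof
  show "typed \<Sigma> \<Gamma> M t \<Longrightarrow> \<exists>D. derives \<Sigma> \<Gamma> D M t"
    by (induction rule: typed.induct) (blast intro: derives.intros)+
  show "\<exists>D. derives \<Sigma> \<Gamma> D M t \<Longrightarrow> typed \<Sigma> \<Gamma> M t"
  proof (elim exE)
    show "derives \<Sigma> \<Gamma> D M t \<Longrightarrow> typed \<Sigma> \<Gamma> M t" for D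
      by (induction rule: derives.induct) (blast intro: typed.intros)+
  qed
qed


section \<open>Structures and the call-by-value semantics\<close>

record ('o, 'm, 'b, 'k, 'e) lc_structure =
  cat :: "('o, 'm) biccc"
  monad :: "('o, 'm) strong_monad"
  base_obj :: "'b \<Rightarrow> 'o"
  interp :: "'k + 'e \<Rightarrow> 'm"

primrec ty_obj :: "('o, 'm, 'b, 'k, 'e) lc_structure \<Rightarrow> 'b ty \<Rightarrow> 'o" where
  "ty_obj A (Base b) = base_obj A b"
| "ty_obj A TOne = One (cat A)"
| "ty_obj A (TProd s t) = Prod (cat A) (ty_obj A s) (ty_obj A t)"
| "ty_obj A TZero = Zero (cat A)"
| "ty_obj A (TSum s t) = Sum (cat A) (ty_obj A s) (ty_obj A t)"
| "ty_obj A (TFun s t) = Exp (cat A) (FObj (monad A) (ty_obj A t)) (ty_obj A s)"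

primrec ctx_obj :: "('o, 'm, 'b, 'k, 'e) lc_structure \<Rightarrow> ('v, 'b) ctx \<Rightarrow> 'o" where
  "ctx_obj A [] = One (cat A)"
| "ctx_obj A (xt # \<Gamma>) = Prod (cat A) (ctx_obj A \<Gamma>) (ty_obj A (snd xt))"

definition lc_structure ::
  "('b, 'k, 'e) signature \<Rightarrow> ('o, 'm, 'b, 'k, 'e) lc_structure \<Rightarrow> bool" where
  "lc_structure \<Sigma> A \<longleftrightarrow>
     stable_biccc (cat A) \<and> strong_monad (cat A) (monad A) \<and>
     (\<forall>b\<in>bases \<Sigma>. base_obj A b \<in> Obj (cat A)) \<and>
     (\<forall>c\<in>consts_of \<Sigma>.
        interp A (Inl c) \<in> hom (cat A) (ty_obj A (ar \<Sigma> (Inl c))) (ty_obj A (car \<Sigma> (Inl c)))) \<and>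
     (\<forall>e\<in>effects_of \<Sigma>.
        interp A (Inr e) \<in> hom (cat A) (ty_obj A (ar \<Sigma> (Inr e)))
                                       (FObj (monad A) (ty_obj A (car \<Sigma> (Inr e)))))"

primrec ctx_proj :: "('o, 'm, 'b, 'k, 'e) lc_structure \<Rightarrow> ('v, 'b) ctx \<Rightarrow> 'v \<Rightarrow> 'm" where
  "ctx_proj A [] x = undefined"
| "ctx_proj A (yt # \<Gamma>) x =
     (if fst yt = x then Pr2 (cat A) (ctx_obj A \<Gamma>) (ty_obj A (snd yt))
      else ctx_proj A \<Gamma> x \<cdot>\<^bsub>cat A\<^esub> Pr1 (cat A) (ctx_obj A \<Gamma>) (ty_obj A (snd yt)))"

text \<open>\<open>T(st) \<circ> st' : T X \<times> T Y \<rightarrow> T (T (X \<times> Y))\<close>\<close>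

definition st_both ::
  "('o, 'm, 'z) biccc_scheme \<Rightarrow> ('o, 'm) strong_monad \<Rightarrow> 'o \<Rightarrow> 'o \<Rightarrow> 'm" where
  "st_both C T X Y = FMap T (Strength T X Y) \<cdot>\<^bsub>C\<^esub> right_strength C T X (FObj T Y)"

text \<open>\<open>sem \<Sigma> A \<Gamma> D : \<lbrakk>\<Gamma>\<rbrakk> \<rightarrow> T \<lbrakk>t\<rbrakk>\<close> interprets a derivation \<open>D\<close> of \<open>\<Gamma> \<turnstile> M : t\<close>.\<close>

primrec sem ::
  "('b, 'k, 'e) signature \<Rightarrow> ('o, 'm, 'b, 'k, 'e) lc_structure \<Rightarrow> ('v, 'b) ctx \<Rightarrow>
   ('v, 'b, 'k, 'e) deriv \<Rightarrow> 'm" where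
  "sem \<Sigma> A \<Gamma> (VarD x) =
     Unit (monad A) (ty_obj A (the (map_of \<Gamma> x))) \<cdot>\<^bsub>cat A\<^esub> ctx_proj A \<Gamma> x"
| "sem \<Sigma> A \<Gamma> (ConstD c D) = FMap (monad A) (interp A (Inl c)) \<cdot>\<^bsub>cat A\<^esub> sem \<Sigma> A \<Gamma> D"
| "sem \<Sigma> A \<Gamma> (EffD e D) =
     Mult (monad A) (ty_obj A (car \<Sigma> (Inr e))) \<cdot>\<^bsub>cat A\<^esub>
     FMap (monad A) (interp A (Inr e)) \<cdot>\<^bsub>cat A\<^esub> sem \<Sigma> A \<Gamma> D"
| "sem \<Sigma> A \<Gamma> TrivD = Unit (monad A) (One (cat A)) \<cdot>\<^bsub>cat A\<^esub> to_one (cat A) (ctx_obj A \<Gamma>)"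
| "sem \<Sigma> A \<Gamma> (PairD t1 t2 D E) =
     Mult (monad A) (Prod (cat A) (ty_obj A t1) (ty_obj A t2)) \<cdot>\<^bsub>cat A\<^esub>
     st_both (cat A) (monad A) (ty_obj A t1) (ty_obj A t2) \<cdot>\<^bsub>cat A\<^esub>
     tuple (cat A) (sem \<Sigma> A \<Gamma> D) (sem \<Sigma> A \<Gamma> E)"
| "sem \<Sigma> A \<Gamma> (Proj1D t1 t2 D) =
     FMap (monad A) (Pr1 (cat A) (ty_obj A t1) (ty_obj A t2)) \<cdot>\<^bsub>cat A\<^esub> sem \<Sigma> A \<Gamma> D"
| "sem \<Sigma> A \<Gamma> (Proj2D t1 t2 D) =
     FMap (monad A) (Pr2 (cat A) (ty_obj A t1) (ty_obj A t2)) \<cdot>\<^bsub>cat A\<^esub> sem \<Sigma> A \<Gamma> D"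
| "sem \<Sigma> A \<Gamma> (AbsurdD t D) =
     FMap (monad A) (from_zero (cat A) (ty_obj A t)) \<cdot>\<^bsub>cat A\<^esub> sem \<Sigma> A \<Gamma> D"
| "sem \<Sigma> A \<Gamma> (Inj1D t1 t2 D) =
     FMap (monad A) (In1 (cat A) (ty_obj A t1) (ty_obj A t2)) \<cdot>\<^bsub>cat A\<^esub> sem \<Sigma> A \<Gamma> D"
| "sem \<Sigma> A \<Gamma> (Inj2D t1 t2 D) =
     FMap (monad A) (In2 (cat A) (ty_obj A t1) (ty_obj A t2)) \<cdot>\<^bsub>cat A\<^esub> sem \<Sigma> A \<Gamma> D"
| "sem \<Sigma> A \<Gamma> (CaseD t D x1 t1 E1 x2 t2 E2) =
     Mult (monad A) (ty_obj A t) \<cdot>\<^bsub>cat A\<^esub>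
     FMap (monad A)
       (cotuple (cat A) (sem \<Sigma> A ((x1, t1) # \<Gamma>) E1) (sem \<Sigma> A ((x2, t2) # \<Gamma>) E2) \<cdot>\<^bsub>cat A\<^esub>
        dist (cat A) (ctx_obj A \<Gamma>) (ty_obj A t1) (ty_obj A t2)) \<cdot>\<^bsub>cat A\<^esub>
     Strength (monad A) (ctx_obj A \<Gamma>) (Sum (cat A) (ty_obj A t1) (ty_obj A t2)) \<cdot>\<^bsub>cat A\<^esub>
     tuple (cat A) (Id (cat A) (ctx_obj A \<Gamma>)) (sem \<Sigma> A \<Gamma> D)"
| "sem \<Sigma> A \<Gamma> (LamD x t1 t2 D) =
     Unit (monad A) (ty_obj A (TFun t1 t2)) \<cdot>\<^bsub>cat A\<^esub>
     transpose (cat A) (ctx_obj A \<Gamma>) (ty_obj A t1) (sem \<Sigma> A ((x, t1) # \<Gamma>) D)"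
| "sem \<Sigma> A \<Gamma> (AppD t1 t2 D E) =
     Mult (monad A) (ty_obj A t2) \<cdot>\<^bsub>cat A\<^esub>
     FMap (monad A) (Mult (monad A) (ty_obj A t2)) \<cdot>\<^bsub>cat A\<^esub>
     FMap (monad A) (FMap (monad A)
       (Ev (cat A) (FObj (monad A) (ty_obj A t2)) (ty_obj A t1))) \<cdot>\<^bsub>cat A\<^esub>
     st_both (cat A) (monad A) (ty_obj A (TFun t1 t2)) (ty_obj A t1) \<cdot>\<^bsub>cat A\<^esub>
     tuple (cat A) (sem \<Sigma> A \<Gamma> D) (sem \<Sigma> A \<Gamma> E)"

definition wp ::
  "('b, 'k, 'e) signature \<Rightarrow> ('o, 'm, 'b, 'k, 'e) lc_structure \<Rightarrow> 'm \<Rightarrow> ('v, 'b) ctx \<Rightarrow>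
   ('v, 'b, 'k, 'e) deriv \<Rightarrow> 'm \<Rightarrow> 'm" where
  "wp \<Sigma> A \<tau> \<Gamma> D Q = \<tau> \<cdot>\<^bsub>cat A\<^esub> FMap (monad A) Q \<cdot>\<^bsub>cat A\<^esub> sem \<Sigma> A \<Gamma> D"

text \<open>The structure \<open>\<alpha>(A)\<close> for \<open>\<alpha> : T \<Rightarrow> U\<close>. Arities and coarities are ground, so their
  interpretations in \<open>A\<close> and in \<open>\<alpha>(A)\<close> coincide.\<close>

definition transport ::
  "('b, 'k, 'e) signature \<Rightarrow> ('o, 'm) strong_monad \<Rightarrow> ('o \<Rightarrow> 'm) \<Rightarrow>
   ('o, 'm, 'b, 'k, 'e) lc_structure \<Rightarrow> ('o, 'm, 'b, 'k, 'e) lc_structure" where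
  "transport \<Sigma> U \<alpha> A = A \<lparr>monad := U,
     interp := (\<lambda>c. case c of
         Inl k \<Rightarrow> interp A (Inl k)
       | Inr e \<Rightarrow> \<alpha> (ty_obj A (car \<Sigma> (Inr e))) \<cdot>\<^bsub>cat A\<^esub> interp A (Inr e))\<rparr>"

end

(* A stage-indexed logical relation between A and alpha(A), in which related elements
   of a ground type are equal. Computations are related by the TT-lifting along alpha: they must
   agree, along alpha, after all pairs of continuations that agree on related values. Since
   sums are only observed through continuations, it suffices to relate maps that factor
   through the same coprojection, so no gluing condition is needed: the relation at a ground type,
   though smaller than equality, still separates continuations, because products distribute over
   sums. Hence at ground types the lifting is u |-> alpha u, and the fundamental lemma says
   that alpha maps the semantics of M in A to its semantics in alpha(A). *)

theory Submission
  imports Defs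
begin

section \<open>Calculating in bicartesian closed categories\<close>

text \<open>A direct induction on the derivation is blocked by subterms of non-ground type: at
  nested arrow types \<alpha> gives no map between the two interpretations, since an argument type
  would need a map in the opposite direction. Hence relations, although the claim concerns ground
  types only. Stages are used because an object need not be determined by its global points.
  Continuations carry a parameter object W because the strength runs a computation inside a context,
  and the answers range over T G and U G for every G, so that the unit at the type itself may serve
  as a continuation; this test is what extracts v = \<alpha> u from the lifting. The small sum
  relation has a price: the identity on the object of a context with sums is in general not related
  to itself, so the fundamental lemma cannot just be evaluated at the identity environment. Density
  is therefore used a second time, for the context, to pass from related environments to an equation
  of morphisms. What then remains is naturality of \<alpha> and the defining equation of the
  query.\<close>

context category
begin

text \<open>The axioms speak of \<open>hom C X Y\<close>, whose endpoints need not occur in the term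
  to be simplified. Recast with \<open>Dom\<close> and \<open>Cod\<close> they become conditional
  rewrite rules, with right-nested composites as normal form.\<close>

lemma comp_arr [simp]:
  assumes "f \<in> Arr C" "g \<in> Arr C" "Cod C f = Dom C g"
  shows "g \<cdot> f \<in> Arr C" "Dom C (g \<cdot> f) = Dom C f" "Cod C (g \<cdot> f) = Cod C g"
  using comp_hom[of f "Dom C f" "Cod C f" g "Cod C g"] assms by (auto simp: hom_def)

lemma id_arr [simp]:
  assumes "X \<in> Obj C"
  shows "Id C X \<in> Arr C" "Dom C (Id C X) = X" "Cod C (Id C X) = X"
  using id_hom[OF assms] by (auto simp: hom_def)

lemma comp_assoc_arr [simp]:
  "\<lbrakk>f \<in> Arr C; g \<in> Arr C; h \<in> Arr C; Cod C f = Dom C g; Cod C g = Dom C h\<rbrakk>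
    \<Longrightarrow> (h \<cdot> g) \<cdot> f = h \<cdot> g \<cdot> f"
  using comp_assoc[of f "Dom C f" "Cod C f" g "Cod C g" h "Cod C h"] by (auto simp: hom_def)

lemma id_comp_arr [simp]: "\<lbrakk>f \<in> Arr C; Cod C f = Y\<rbrakk> \<Longrightarrow> Id C Y \<cdot> f = f"
  using id_left[of f "Dom C f" Y] by (auto simp: hom_def)

lemma comp_id_arr [simp]: "\<lbrakk>f \<in> Arr C; Dom C f = X\<rbrakk> \<Longrightarrow> f \<cdot> Id C X = f"
  using id_right[of f X "Cod C f"] by (auto simp: hom_def)

lemma dom_cod_obj [simp]: "f \<in> Arr C \<Longrightarrow> Dom C f \<in> Obj C" "f \<in> Arr C \<Longrightarrow> Cod C f \<in> Obj C"
  by (simp_all add: dom_obj cod_obj)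

end

context biccc
begin

lemma one_obj [simp]: "One C \<in> Obj C"
  and zero_obj [simp]: "Zero C \<in> Obj C"
  using one_terminal zero_initial by (auto simp: is_terminal_def is_initial_def)

lemma prod_arr [simp]:
  assumes "X \<in> Obj C" "Y \<in> Obj C"
  shows "Prod C X Y \<in> Obj C"
    "Pr1 C X Y \<in> Arr C" "Dom C (Pr1 C X Y) = Prod C X Y" "Cod C (Pr1 C X Y) = X"
    "Pr2 C X Y \<in> Arr C" "Dom C (Pr2 C X Y) = Prod C X Y" "Cod C (Pr2 C X Y) = Y"
  using prod_product[OF assms] by (auto simp: is_product_def hom_def)

lemma sum_arr [simp]:
  assumes "X \<in> Obj C" "Y \<in> Obj C"
  shows "Sum C X Y \<in> Obj C"
    "In1 C X Y \<in> Arr C" "Dom C (In1 C X Y) = X" "Cod C (In1 C X Y) = Sum C X Y"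
    "In2 C X Y \<in> Arr C" "Dom C (In2 C X Y) = Y" "Cod C (In2 C X Y) = Sum C X Y"
  using sum_coproduct[OF assms] by (auto simp: is_coproduct_def hom_def)

declare exp_obj [simp]

lemma ev_arr [simp]:
  assumes "X \<in> Obj C" "Y \<in> Obj C"
  shows "Ev C X Y \<in> Arr C" "Dom C (Ev C X Y) = Prod C (Exp C X Y) Y" "Cod C (Ev C X Y) = X"
  using ev_hom[OF assms] by (auto simp: hom_def)

lemma to_one_arr [simp]:
  assumes "X \<in> Obj C"
  shows "to_one C X \<in> Arr C" "Dom C (to_one C X) = X" "Cod C (to_one C X) = One C"
proof -
  have "\<exists>!f. f \<in> hom C X (One C)"
    using one_terminal assms by (auto simp: is_terminal_def)
  from theI'[OF this] show "to_one C X \<in> Arr C" "Dom C (to_one C X) = X" "Cod C (to_one C X) = One C"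
    by (auto simp: to_one_def hom_def)
qed

lemma to_one_eq:
  assumes "f \<in> Arr C" "g \<in> Arr C" "Dom C f = Dom C g" "Cod C f = One C" "Cod C g = One C"
  shows "f = g"
  using one_terminal assms dom_obj[of g] unfolding is_terminal_def hom_def by blast

lemma from_zero_arr [simp]:
  assumes "X \<in> Obj C"
  shows "from_zero C X \<in> Arr C" "Dom C (from_zero C X) = Zero C" "Cod C (from_zero C X) = X"
proof -
  have "\<exists>!f. f \<in> hom C (Zero C) X"
    using zero_initial assms by (auto simp: is_initial_def)
  from theI'[OF this] show "from_zero C X \<in> Arr C" "Dom C (from_zero C X) = Zero C"
    "Cod C (from_zero C X) = X"
    by (auto simp: from_zero_def hom_def)
qed

lemma from_zero_eq:
  assumes "f \<in> Arr C" "g \<in> Arr C" "Dom C f = Zero C" "Dom C g = Zero C" "Cod C f = Cod C g"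
  shows "f = g"
  using zero_initial assms cod_obj[of g] unfolding is_initial_def hom_def by blast

section \<open>Binary products: pairing\<close>

lemma tuple_ex1:
  assumes "f \<in> Arr C" "g \<in> Arr C" "Dom C f = Dom C g"
  shows "\<exists>!h. h \<in> hom C (Dom C f) (Prod C (Cod C f) (Cod C g)) \<and>
      Pr1 C (Cod C f) (Cod C g) \<cdot> h = f \<and> Pr2 C (Cod C f) (Cod C g) \<cdot> h = g"
proof -
  have "is_product C (Cod C f) (Cod C g) (Prod C (Cod C f) (Cod C g))
      (Pr1 C (Cod C f) (Cod C g)) (Pr2 C (Cod C f) (Cod C g))"
    by (rule prod_product) (simp_all add: assms)
  moreover have "f \<in> hom C (Dom C f) (Cod C f)" "g \<in> hom C (Dom C f) (Cod C g)"
    using assms by (simp_all add: hom_def)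
  ultimately show ?thesis
    using assms(1) dom_obj[of f] unfolding is_product_def by blast
qed

lemma tuple_arr [simp]:
  assumes "f \<in> Arr C" "g \<in> Arr C" "Dom C f = Dom C g"
  shows "tuple C f g \<in> Arr C" "Dom C (tuple C f g) = Dom C f"
    "Cod C (tuple C f g) = Prod C (Cod C f) (Cod C g)"
  using theI'[OF tuple_ex1[OF assms]] by (auto simp: tuple_def hom_def)

lemma pr_tuple [simp]:
  assumes "f \<in> Arr C" "g \<in> Arr C" "Dom C f = Dom C g" "Cod C f = X" "Cod C g = Y"
  shows "Pr1 C X Y \<cdot> tuple C f g = f" "Pr2 C X Y \<cdot> tuple C f g = g"
  using theI'[OF tuple_ex1[OF assms(1-3)]] assms(4,5) by (auto simp: tuple_def hom_def)

lemma tuple_eqI: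
  assumes "h \<in> Arr C" "k \<in> Arr C" "Dom C h = Dom C k" "Cod C h = Prod C X Y" "Cod C k = Prod C X Y"
    "X \<in> Obj C" "Y \<in> Obj C"
    "Pr1 C X Y \<cdot> h = Pr1 C X Y \<cdot> k" "Pr2 C X Y \<cdot> h = Pr2 C X Y \<cdot> k"
  shows "h = k"
proof -
  have "\<exists>!h. h \<in> hom C (Dom C k) (Prod C X Y) \<and>
      Pr1 C X Y \<cdot> h = Pr1 C X Y \<cdot> k \<and> Pr2 C X Y \<cdot> h = Pr2 C X Y \<cdot> k"
    using tuple_ex1[of "Pr1 C X Y \<cdot> k" "Pr2 C X Y \<cdot> k"] assms by simp
  then show ?thesis
    using assms by (auto simp: hom_def)
qed

lemma tuple_comp [simp]:
  assumes "f \<in> Arr C" "g \<in> Arr C" "h \<in> Arr C" "Dom C f = Dom C g" "Cod C h = Dom C g"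
  shows "tuple C f g \<cdot> h = tuple C (f \<cdot> h) (g \<cdot> h)"
proof (rule tuple_eqI[where X = "Cod C f" and Y = "Cod C g"])
  have "Pr1 C (Cod C f) (Cod C g) \<cdot> tuple C f g \<cdot> h = (Pr1 C (Cod C f) (Cod C g) \<cdot> tuple C f g) \<cdot> h"
    using assms by (subst comp_assoc_arr) simp_all
  then show "Pr1 C (Cod C f) (Cod C g) \<cdot> tuple C f g \<cdot> h
      = Pr1 C (Cod C f) (Cod C g) \<cdot> tuple C (f \<cdot> h) (g \<cdot> h)"
    using assms by simp
  have "Pr2 C (Cod C f) (Cod C g) \<cdot> tuple C f g \<cdot> h = (Pr2 C (Cod C f) (Cod C g) \<cdot> tuple C f g) \<cdot> h"
    using assms by (subst comp_assoc_arr) simp_all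
  then show "Pr2 C (Cod C f) (Cod C g) \<cdot> tuple C f g \<cdot> h
      = Pr2 C (Cod C f) (Cod C g) \<cdot> tuple C (f \<cdot> h) (g \<cdot> h)"
    using assms by simp
qed (use assms in simp_all)

lemma tuple_pr [simp]:
  assumes "X \<in> Obj C" "Y \<in> Obj C"
  shows "tuple C (Pr1 C X Y) (Pr2 C X Y) = Id C (Prod C X Y)"
  by (rule tuple_eqI[where X = X and Y = Y]) (use assms in simp_all)

text \<open>Surjective pairing for composites: \<open>tuple_comp\<close> pushes every right factor
  into the pair, where \<open>tuple_pr\<close> no longer matches.\<close>

lemma tuple_pr_comp [simp]:
  assumes "X \<in> Obj C" "Y \<in> Obj C" "h \<in> Arr C" "Cod C h = Prod C X Y"
  shows "tuple C (Pr1 C X Y \<cdot> h) (Pr2 C X Y \<cdot> h) = h"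
  by (rule tuple_eqI[where X = X and Y = Y]) (use assms in simp_all)

lemma prod_map_eq:
  "prod_map C f g = tuple C (f \<cdot> Pr1 C (Dom C f) (Dom C g)) (g \<cdot> Pr2 C (Dom C f) (Dom C g))"
  by (simp add: prod_map_def)

section \<open>Exponentials: the beta and eta laws of transposition\<close>

lemma transpose_ex1:
  assumes "f \<in> Arr C" "Dom C f = Prod C Z Y" "Z \<in> Obj C" "Y \<in> Obj C"
  shows "\<exists>!g. g \<in> hom C Z (Exp C (Cod C f) Y) \<and> Ev C (Cod C f) Y \<cdot> prod_map C g (Id C Y) = f"
  by (rule exp_universal) (use assms in \<open>simp_all add: hom_def\<close>)

lemma transpose_arr [simp]:
  assumes "f \<in> Arr C" "Dom C f = Prod C Z Y" "Z \<in> Obj C" "Y \<in> Obj C"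
  shows "transpose C Z Y f \<in> Arr C" "Dom C (transpose C Z Y f) = Z"
    "Cod C (transpose C Z Y f) = Exp C (Cod C f) Y"
  using theI'[OF transpose_ex1[OF assms]] by (auto simp: transpose_def hom_def)

text \<open>The beta law, precomposed with an arbitrary pair: once \<open>prod_map\<close> is
  unfolded, evaluation is only ever met in this shape.\<close>

lemma ev_transpose:
  assumes "f \<in> Arr C" "Dom C f = Prod C Z Y" "Cod C f = X" "Z \<in> Obj C" "Y \<in> Obj C"
    "a \<in> Arr C" "b \<in> Arr C" "Cod C a = Z" "Cod C b = Y" "Dom C a = Dom C b"
  shows "Ev C X Y \<cdot> tuple C (transpose C Z Y f \<cdot> a) b = f \<cdot> tuple C a b"
proof -
  have X: "X \<in> Obj C"
    using assms by auto
  have "Ev C X Y \<cdot> prod_map C (transpose C Z Y f) (Id C Y) = f"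
    using theI'[OF transpose_ex1[OF assms(1,2,4,5)]] assms(3) by (auto simp: transpose_def)
  then have "(Ev C X Y \<cdot> prod_map C (transpose C Z Y f) (Id C Y)) \<cdot> tuple C a b = f \<cdot> tuple C a b"
    by simp
  then show ?thesis
    using assms X by (simp add: prod_map_eq)
qed

lemma ev_eqI:
  assumes "f \<in> Arr C" "g \<in> Arr C" "Dom C f = Z" "Dom C g = Z" "Cod C f = Exp C X Y"
    "Cod C g = Exp C X Y" "X \<in> Obj C" "Y \<in> Obj C"
    "Ev C X Y \<cdot> tuple C (f \<cdot> Pr1 C Z Y) (Pr2 C Z Y) = Ev C X Y \<cdot> tuple C (g \<cdot> Pr1 C Z Y) (Pr2 C Z Y)"
  shows "f = g"
proof -
  have Z: "Z \<in> Obj C"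
    using assms by auto
  let ?h = "Ev C X Y \<cdot> tuple C (f \<cdot> Pr1 C Z Y) (Pr2 C Z Y)"
  have "\<exists>!k. k \<in> hom C Z (Exp C X Y) \<and> Ev C X Y \<cdot> prod_map C k (Id C Y) = ?h"
    by (rule exp_universal) (use assms Z in \<open>simp_all add: hom_def\<close>)
  moreover have "Ev C X Y \<cdot> prod_map C f (Id C Y) = ?h" "Ev C X Y \<cdot> prod_map C g (Id C Y) = ?h"
    using assms Z by (simp_all add: prod_map_eq)
  ultimately show ?thesis
    using assms unfolding hom_def by blast
qed

section \<open>Coproducts and their distribution over products\<close>

lemma cotuple_ex1:
  assumes "f \<in> Arr C" "g \<in> Arr C" "Cod C f = Cod C g"
  shows "\<exists>!h. h \<in> hom C (Sum C (Dom C f) (Dom C g)) (Cod C f) \<and>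
      h \<cdot> In1 C (Dom C f) (Dom C g) = f \<and> h \<cdot> In2 C (Dom C f) (Dom C g) = g"
proof -
  have "is_coproduct C (Dom C f) (Dom C g) (Sum C (Dom C f) (Dom C g))
      (In1 C (Dom C f) (Dom C g)) (In2 C (Dom C f) (Dom C g))"
    by (rule sum_coproduct) (simp_all add: assms)
  moreover have "f \<in> hom C (Dom C f) (Cod C f)" "g \<in> hom C (Dom C g) (Cod C f)"
    using assms by (simp_all add: hom_def)
  ultimately show ?thesis
    using assms(1) cod_obj[of f] unfolding is_coproduct_def by blast
qed

lemma cotuple_arr [simp]:
  assumes "f \<in> Arr C" "g \<in> Arr C" "Cod C f = Cod C g"
  shows "cotuple C f g \<in> Arr C" "Dom C (cotuple C f g) = Sum C (Dom C f) (Dom C g)"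
    "Cod C (cotuple C f g) = Cod C f"
  using theI'[OF cotuple_ex1[OF assms]] by (auto simp: cotuple_def hom_def)

lemma cotuple_in [simp]:
  assumes "f \<in> Arr C" "g \<in> Arr C" "Cod C f = Cod C g" "Dom C f = X" "Dom C g = Y"
  shows "cotuple C f g \<cdot> In1 C X Y = f" "cotuple C f g \<cdot> In2 C X Y = g"
  using theI'[OF cotuple_ex1[OF assms(1-3)]] assms(4,5) by (auto simp: cotuple_def hom_def)

lemma cotuple_in_comp [simp]:
  assumes "f \<in> Arr C" "g \<in> Arr C" "Cod C f = Cod C g" "Dom C f = X" "Dom C g = Y" "h \<in> Arr C"
  shows "Cod C h = X \<Longrightarrow> cotuple C f g \<cdot> In1 C X Y \<cdot> h = f \<cdot> h"
    "Cod C h = Y \<Longrightarrow> cotuple C f g \<cdot> In2 C X Y \<cdot> h = g \<cdot> h"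
proof -
  have *: "X \<in> Obj C" "Y \<in> Obj C"
    using assms by auto
  show "cotuple C f g \<cdot> In1 C X Y \<cdot> h = f \<cdot> h" if "Cod C h = X"
    using assms * that comp_assoc_arr[of h "In1 C X Y" "cotuple C f g"] by simp
  show "cotuple C f g \<cdot> In2 C X Y \<cdot> h = g \<cdot> h" if "Cod C h = Y"
    using assms * that comp_assoc_arr[of h "In2 C X Y" "cotuple C f g"] by simp
qed

lemma cotuple_eqI:
  assumes "h \<in> Arr C" "k \<in> Arr C" "Cod C h = Cod C k" "Dom C h = Sum C X Y" "Dom C k = Sum C X Y"
    "X \<in> Obj C" "Y \<in> Obj C"
    "h \<cdot> In1 C X Y = k \<cdot> In1 C X Y" "h \<cdot> In2 C X Y = k \<cdot> In2 C X Y"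
  shows "h = k"
proof -
  have "\<exists>!h. h \<in> hom C (Sum C X Y) (Cod C k) \<and>
      h \<cdot> In1 C X Y = k \<cdot> In1 C X Y \<and> h \<cdot> In2 C X Y = k \<cdot> In2 C X Y"
    using cotuple_ex1[of "k \<cdot> In1 C X Y" "k \<cdot> In2 C X Y"] assms by simp
  then show ?thesis
    using assms by (auto simp: hom_def)
qed

text \<open>Curried in the first factor, both hypotheses compare maps out of the coproduct \<open>X + Y\<close>.\<close>

lemma prod_sum_eqI:
  assumes "k \<in> Arr C" "l \<in> Arr C" "Dom C k = Prod C W (Sum C X Y)" "Dom C l = Prod C W (Sum C X Y)"
    "Cod C k = Cod C l" and obj: "W \<in> Obj C" "X \<in> Obj C" "Y \<in> Obj C"
    and in1: "k \<cdot> tuple C (Pr1 C W X) (In1 C X Y \<cdot> Pr2 C W X)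
      = l \<cdot> tuple C (Pr1 C W X) (In1 C X Y \<cdot> Pr2 C W X)"
    and in2: "k \<cdot> tuple C (Pr1 C W Y) (In2 C X Y \<cdot> Pr2 C W Y)
      = l \<cdot> tuple C (Pr1 C W Y) (In2 C X Y \<cdot> Pr2 C W Y)"
  shows "k = l"
proof -
  let ?S = "Sum C X Y" and ?V = "Cod C l"
  \<comment> \<open>Transposition abstracts the right factor. The swap puts W there and leaves a map
    out of the coproduct.\<close>
  define sw where "sw = tuple C (Pr2 C ?S W) (Pr1 C ?S W)"
  have sw [simp]: "sw \<in> Arr C" "Dom C sw = Prod C ?S W" "Cod C sw = Prod C W ?S"
    using obj by (simp_all add: sw_def)
  have eq: "k \<cdot> tuple C a (In1 C X Y \<cdot> b) = l \<cdot> tuple C a (In1 C X Y \<cdot> b)"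
    if "a \<in> Arr C" "b \<in> Arr C" "Dom C a = Dom C b" "Cod C a = W" "Cod C b = X" for a b
    using arg_cong[OF in1, of "\<lambda>m. m \<cdot> tuple C a b"] that assms(1-8) by simp
  have eq': "k \<cdot> tuple C a (In2 C X Y \<cdot> b) = l \<cdot> tuple C a (In2 C X Y \<cdot> b)"
    if "a \<in> Arr C" "b \<in> Arr C" "Dom C a = Dom C b" "Cod C a = W" "Cod C b = Y" for a b
    using arg_cong[OF in2, of "\<lambda>m. m \<cdot> tuple C a b"] that assms(1-8) by simp
  have "transpose C ?S W (k \<cdot> sw) = transpose C ?S W (l \<cdot> sw)"
  proof (rule cotuple_eqI[where X = X and Y = Y])
    show "transpose C ?S W (k \<cdot> sw) \<cdot> In1 C X Y = transpose C ?S W (l \<cdot> sw) \<cdot> In1 C X Y"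
      by (rule ev_eqI[where Z = X and X = ?V and Y = W])
        (use assms(1-8) in \<open>simp_all add: ev_transpose sw_def eq\<close>)
    show "transpose C ?S W (k \<cdot> sw) \<cdot> In2 C X Y = transpose C ?S W (l \<cdot> sw) \<cdot> In2 C X Y"
      by (rule ev_eqI[where Z = Y and X = ?V and Y = W])
        (use assms(1-8) in \<open>simp_all add: ev_transpose sw_def eq'\<close>)
  qed (use assms(1-8) in simp_all)
  \<comment> \<open>Evaluating both transposes at the swapped projections undoes the currying and
    the swap.\<close>
  then have "Ev C ?V W \<cdot> tuple C (transpose C ?S W (k \<cdot> sw) \<cdot> Pr2 C W ?S) (Pr1 C W ?S)
    = Ev C ?V W \<cdot> tuple C (transpose C ?S W (l \<cdot> sw) \<cdot> Pr2 C W ?S) (Pr1 C W ?S)"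
    by simp
  then show ?thesis
    using assms(1-8) by (simp add: ev_transpose sw_def)
qed

text \<open>The nullary analogue: once W is abstracted, both maps start at the initial
  object.\<close>

lemma prod_zero_eq:
  assumes "k \<in> Arr C" "l \<in> Arr C" "Dom C k = Prod C W (Zero C)" "Dom C l = Prod C W (Zero C)"
    "Cod C k = Cod C l" "W \<in> Obj C"
  shows "k = l"
proof -
  let ?S = "Zero C" and ?V = "Cod C l"
  define sw where "sw = tuple C (Pr2 C ?S W) (Pr1 C ?S W)"
  have sw [simp]: "sw \<in> Arr C" "Dom C sw = Prod C ?S W" "Cod C sw = Prod C W ?S"
    using assms by (simp_all add: sw_def)
  have "transpose C ?S W (k \<cdot> sw) = transpose C ?S W (l \<cdot> sw)"
    by (rule from_zero_eq) (use assms in simp_all)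
  then have "Ev C ?V W \<cdot> tuple C (transpose C ?S W (k \<cdot> sw) \<cdot> Pr2 C W ?S) (Pr1 C W ?S)
    = Ev C ?V W \<cdot> tuple C (transpose C ?S W (l \<cdot> sw) \<cdot> Pr2 C W ?S) (Pr1 C W ?S)"
    by simp
  then show ?thesis
    using assms by (simp add: ev_transpose sw_def)
qed

text \<open>\<open>dist\<close> is a definite description of a two-sided inverse, so the inverse has
  to be built first. Cartesian closure provides it: a map out of the product with a coproduct is
  obtained by cotupling transposes.\<close>

lemma dist_spec:
  assumes obj: "X \<in> Obj C" "Y \<in> Obj C" "Z \<in> Obj C"
  shows "dist C X Y Z \<in> Arr C \<and> Dom C (dist C X Y Z) = Prod C X (Sum C Y Z)
    \<and> Cod C (dist C X Y Z) = Sum C (Prod C X Y) (Prod C X Z)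
    \<and> dist C X Y Z \<cdot> cotuple C (prod_map C (Id C X) (In1 C Y Z)) (prod_map C (Id C X) (In2 C Y Z))
      = Id C (Sum C (Prod C X Y) (Prod C X Z))"
proof -
  let ?P = "Prod C X (Sum C Y Z)" and ?S = "Sum C (Prod C X Y) (Prod C X Z)"
  define c where "c = cotuple C (prod_map C (Id C X) (In1 C Y Z)) (prod_map C (Id C X) (In2 C Y Z))"
  \<comment> \<open>The coprojections with their arguments swapped: their transposes start at Y and
    Z, so they can be cotupled, and \<open>d\<close> evaluates the result.\<close>
  define i1 where "i1 = In1 C (Prod C X Y) (Prod C X Z) \<cdot> tuple C (Pr2 C Y X) (Pr1 C Y X)"
  define i2 where "i2 = In2 C (Prod C X Y) (Prod C X Z) \<cdot> tuple C (Pr2 C Z X) (Pr1 C Z X)"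
  have i [simp]: "i1 \<in> Arr C" "Dom C i1 = Prod C Y X" "Cod C i1 = ?S"
    "i2 \<in> Arr C" "Dom C i2 = Prod C Z X" "Cod C i2 = ?S"
    using obj by (simp_all add: i1_def i2_def)
  define d where "d = Ev C ?S X \<cdot>
    tuple C (cotuple C (transpose C Y X i1) (transpose C Z X i2) \<cdot> Pr2 C X (Sum C Y Z))
      (Pr1 C X (Sum C Y Z))"
  have c [simp]: "c \<in> Arr C" "Dom C c = ?S" "Cod C c = ?P"
    using obj by (simp_all add: c_def prod_map_eq)
  have d [simp]: "d \<in> Arr C" "Dom C d = ?P" "Cod C d = ?S"
    using obj by (simp_all add: d_def)
  have c_in: "c \<cdot> In1 C (Prod C X Y) (Prod C X Z) = tuple C (Pr1 C X Y) (In1 C Y Z \<cdot> Pr2 C X Y)"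
    "c \<cdot> In2 C (Prod C X Y) (Prod C X Z) = tuple C (Pr1 C X Z) (In2 C Y Z \<cdot> Pr2 C X Z)"
    using obj by (simp_all add: c_def prod_map_eq)
  have d_in: "d \<cdot> tuple C (Pr1 C X Y) (In1 C Y Z \<cdot> Pr2 C X Y) = In1 C (Prod C X Y) (Prod C X Z)"
    "d \<cdot> tuple C (Pr1 C X Z) (In2 C Y Z \<cdot> Pr2 C X Z) = In2 C (Prod C X Y) (Prod C X Z)"
    using obj by (simp_all add: d_def ev_transpose) (simp_all add: i1_def i2_def)
  have dc: "d \<cdot> c = Id C ?S"
    by (rule cotuple_eqI[where X = "Prod C X Y" and Y = "Prod C X Z"]) (use obj in \<open>simp_all add: c_in d_in\<close>)
  have cd: "c \<cdot> d = Id C ?P"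
    by (rule prod_sum_eqI[where W = X and X = Y and Y = Z]) (use obj in \<open>simp_all add: c_in d_in\<close>)
  have "dist C X Y Z = (THE d. d \<in> hom C ?P ?S \<and> d \<cdot> c = Id C ?S \<and> c \<cdot> d = Id C ?P)"
    by (simp add: dist_def c_def Let_def)
  also have "\<dots> = d"
  proof (rule the_equality)
    show "d \<in> hom C ?P ?S \<and> d \<cdot> c = Id C ?S \<and> c \<cdot> d = Id C ?P"
      using dc cd by (simp add: hom_def)
    fix e
    assume e: "e \<in> hom C ?P ?S \<and> e \<cdot> c = Id C ?S \<and> c \<cdot> e = Id C ?P"
    then have e': "e \<in> Arr C" "Dom C e = ?P" "Cod C e = ?S" and ec: "e \<cdot> c = Id C ?S"
      by (auto simp: hom_def)
    have "e = e \<cdot> c \<cdot> d"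
      using e' by (simp add: cd)
    also have "\<dots> = (e \<cdot> c) \<cdot> d"
      using e' by simp
    finally show "e = d"
      by (simp add: ec)
  qed
  finally show ?thesis
    using dc by (simp add: c_def)
qed

lemma dist_arr [simp]:
  assumes "X \<in> Obj C" "Y \<in> Obj C" "Z \<in> Obj C"
  shows "dist C X Y Z \<in> Arr C" "Dom C (dist C X Y Z) = Prod C X (Sum C Y Z)"
    "Cod C (dist C X Y Z) = Sum C (Prod C X Y) (Prod C X Z)"
  using dist_spec[OF assms] by auto

text \<open>Computes \<open>dist\<close> on the only pairs that the sum relation will produce, those
  whose second component factors through a coprojection.\<close>

lemma dist_tuple_in:
  assumes obj: "X \<in> Obj C" "Y \<in> Obj C" "Z \<in> Obj C"
    and "a \<in> Arr C" "b \<in> Arr C" "Dom C a = Dom C b" "Cod C a = X"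
  shows "Cod C b = Y \<Longrightarrow>
      dist C X Y Z \<cdot> tuple C a (In1 C Y Z \<cdot> b) = In1 C (Prod C X Y) (Prod C X Z) \<cdot> tuple C a b"
    and "Cod C b = Z \<Longrightarrow>
      dist C X Y Z \<cdot> tuple C a (In2 C Y Z \<cdot> b) = In2 C (Prod C X Y) (Prod C X Z) \<cdot> tuple C a b"
proof -
  let ?c = "cotuple C (prod_map C (Id C X) (In1 C Y Z)) (prod_map C (Id C X) (In2 C Y Z))"
  have pm: "prod_map C (Id C X) (In1 C Y Z) = tuple C (Pr1 C X Y) (In1 C Y Z \<cdot> Pr2 C X Y)"
    "prod_map C (Id C X) (In2 C Y Z) = tuple C (Pr1 C X Z) (In2 C Y Z \<cdot> Pr2 C X Z)"
    using obj by (simp_all add: prod_map_eq)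
  have spec: "dist C X Y Z \<cdot> ?c = Id C (Sum C (Prod C X Y) (Prod C X Z))"
    using dist_spec[OF obj] by simp
  show "dist C X Y Z \<cdot> tuple C a (In1 C Y Z \<cdot> b) = In1 C (Prod C X Y) (Prod C X Z) \<cdot> tuple C a b"
    if "Cod C b = Y"
    using arg_cong[OF spec, of "\<lambda>m. m \<cdot> In1 C (Prod C X Y) (Prod C X Z) \<cdot> tuple C a b"] that assms
    by (simp add: pm)
  show "dist C X Y Z \<cdot> tuple C a (In2 C Y Z \<cdot> b) = In2 C (Prod C X Y) (Prod C X Z) \<cdot> tuple C a b"
    if "Cod C b = Z"
    using arg_cong[OF spec, of "\<lambda>m. m \<cdot> In2 C (Prod C X Y) (Prod C X Z) \<cdot> tuple C a b"] that assms
    by (simp add: pm)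
qed

end


section \<open>Strong monads\<close>

text \<open>Kleisli extension of \<open>k : W \<times> X \<rightarrow> T Y\<close> with parameters in \<open>W\<close>, applied to \<open>u : W \<rightarrow> T X\<close>.\<close>

definition bind ::
  "('o, 'm, 'z) biccc_scheme \<Rightarrow> ('o, 'm) strong_monad \<Rightarrow> 'o \<Rightarrow> 'o \<Rightarrow> 'm \<Rightarrow> 'm \<Rightarrow> 'm" where
  "bind C T X Y k u = Mult T Y \<cdot>\<^bsub>C\<^esub> FMap T k \<cdot>\<^bsub>C\<^esub>
     Strength T (Dom C u) X \<cdot>\<^bsub>C\<^esub> tuple C (Id C (Dom C u)) u"

context strong_monad
begin

declare fobj [simp]

lemma fmap_arr [simp]:
  assumes "f \<in> Arr C"
  shows "FMap T f \<in> Arr C" "Dom C (FMap T f) = FObj T (Dom C f)"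
    "Cod C (FMap T f) = FObj T (Cod C f)"
  using fmap_hom[of f "Dom C f" "Cod C f"] assms by (auto simp: hom_def)

lemma unit_arr [simp]:
  assumes "X \<in> Obj C"
  shows "Unit T X \<in> Arr C" "Dom C (Unit T X) = X" "Cod C (Unit T X) = FObj T X"
  using unit_hom[OF assms] by (auto simp: hom_def)

lemma mult_arr [simp]:
  assumes "X \<in> Obj C"
  shows "Mult T X \<in> Arr C" "Dom C (Mult T X) = FObj T (FObj T X)" "Cod C (Mult T X) = FObj T X"
  using mult_hom[OF assms] by (auto simp: hom_def)

lemma strength_arr [simp]:
  assumes "X \<in> Obj C" "W \<in> Obj C"
  shows "Strength T X W \<in> Arr C" "Dom C (Strength T X W) = Prod C X (FObj T W)"
    "Cod C (Strength T X W) = FObj T (Prod C X W)"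
  using strength_hom[OF assms] by (auto simp: hom_def)

declare fmap_id [simp]

lemma fmap_fmap [simp]:
  "\<lbrakk>f \<in> Arr C; g \<in> Arr C; Cod C f = Dom C g\<rbrakk> \<Longrightarrow> FMap T g \<cdot> FMap T f = FMap T (g \<cdot> f)"
  using fmap_comp[of f "Dom C f" "Cod C f" g "Cod C g"] by (auto simp: hom_def)

text \<open>Composites are nested to the right, so a law about two adjacent factors must also be
  available with a trailing factor. The other lemmas ending in \<open>_comp\<close> in this context
  serve the same purpose, except \<open>strength_tuple_comp\<close> and
  \<open>bind_comp\<close>.\<close>

lemma fmap_fmap_comp [simp]:
  "\<lbrakk>f \<in> Arr C; g \<in> Arr C; h \<in> Arr C; Cod C f = Dom C g; Cod C h = FObj T (Dom C f)\<rbrakk>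
    \<Longrightarrow> FMap T g \<cdot> FMap T f \<cdot> h = FMap T (g \<cdot> f) \<cdot> h"
  using comp_assoc_arr[of h "FMap T f" "FMap T g"] by simp

lemma fmap_unit [simp]:
  "\<lbrakk>f \<in> Arr C; Dom C f = X\<rbrakk> \<Longrightarrow> FMap T f \<cdot> Unit T X = Unit T (Cod C f) \<cdot> f"
  using unit_natural[of f X "Cod C f"] by (auto simp: hom_def)

lemma fmap_unit_comp [simp]:
  "\<lbrakk>f \<in> Arr C; h \<in> Arr C; Dom C f = X; Cod C h = X\<rbrakk>
    \<Longrightarrow> FMap T f \<cdot> Unit T X \<cdot> h = Unit T (Cod C f) \<cdot> f \<cdot> h"
  using comp_assoc_arr[of h "Unit T X" "FMap T f"] by auto

lemma fmap_mult [simp]: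
  "\<lbrakk>f \<in> Arr C; Dom C f = X\<rbrakk> \<Longrightarrow> FMap T f \<cdot> Mult T X = Mult T (Cod C f) \<cdot> FMap T (FMap T f)"
  using mult_natural[of f X "Cod C f"] by (auto simp: hom_def)

lemma fmap_mult_comp [simp]:
  "\<lbrakk>f \<in> Arr C; h \<in> Arr C; Dom C f = X; Cod C h = FObj T (FObj T X)\<rbrakk>
    \<Longrightarrow> FMap T f \<cdot> Mult T X \<cdot> h = Mult T (Cod C f) \<cdot> FMap T (FMap T f) \<cdot> h"
  using comp_assoc_arr[of h "Mult T X" "FMap T f"] by auto

lemma mult_unit_comp [simp]:
  "\<lbrakk>h \<in> Arr C; Cod C h = FObj T X; X \<in> Obj C\<rbrakk> \<Longrightarrow> Mult T X \<cdot> Unit T (FObj T X) \<cdot> h = h"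
  using comp_assoc_arr[of h "Unit T (FObj T X)" "Mult T X"] by (simp add: mult_unit_left)

text \<open>The right unit law in the shape it has after \<open>fmap_fmap\<close> has merged
  adjacent functor images.\<close>

lemma mult_fmap_unit [simp]:
  assumes "g \<in> Arr C" "Cod C g = X"
  shows "Mult T X \<cdot> FMap T (Unit T X \<cdot> g) = FMap T g"
proof -
  have X: "X \<in> Obj C"
    using assms by auto
  have "Mult T X \<cdot> FMap T (Unit T X \<cdot> g) = (Mult T X \<cdot> FMap T (Unit T X)) \<cdot> FMap T g"
    using assms X by simp
  then show ?thesis
    using assms X by (simp only: mult_unit_right) simp
qed

lemma mult_fmap_unit_comp [simp]:
  "\<lbrakk>g \<in> Arr C; Cod C g = X; h \<in> Arr C; Cod C h = FObj T (Dom C g)\<rbrakk>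
    \<Longrightarrow> Mult T X \<cdot> FMap T (Unit T X \<cdot> g) \<cdot> h = FMap T g \<cdot> h"
  using comp_assoc_arr[of h "FMap T (Unit T X \<cdot> g)" "Mult T X"] by auto

lemma mult_mult [simp]:
  "\<lbrakk>h \<in> Arr C; X \<in> Obj C; Cod C h = FObj T (FObj T (FObj T X))\<rbrakk>
    \<Longrightarrow> Mult T X \<cdot> Mult T (FObj T X) \<cdot> h = Mult T X \<cdot> FMap T (Mult T X) \<cdot> h"
  using comp_assoc_arr[of h "Mult T (FObj T X)" "Mult T X"]
    comp_assoc_arr[of h "FMap T (Mult T X)" "Mult T X"] by (simp add: mult_assoc)

section \<open>The laws of the strength, evaluated at a pair\<close>

lemma strength_tuple_fmap:
  assumes "a \<in> Arr C" "u \<in> Arr C" "Dom C a = Dom C u" "Cod C a = X" "Cod C u = FObj T W"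
    "g \<in> Arr C" "Dom C g = W" "Cod C g = W'"
  shows "Strength T X W' \<cdot> tuple C a (FMap T g \<cdot> u)
    = FMap T (tuple C (Pr1 C X W) (g \<cdot> Pr2 C X W)) \<cdot> Strength T X W \<cdot> tuple C a u"
proof -
  have obj: "X \<in> Obj C" "W \<in> Obj C" "W' \<in> Obj C"
    using assms by auto
  have "Strength T X W' \<cdot> prod_map C (Id C X) (FMap T g)
    = FMap T (prod_map C (Id C X) g) \<cdot> Strength T X W"
    by (rule strength_natural) (use assms obj in \<open>simp_all add: hom_def\<close>)
  from arg_cong[OF this, of "\<lambda>m. m \<cdot> tuple C a u"] show ?thesis
    using assms obj by (simp add: prod_map_eq)
qed

lemma strength_tuple_comp:
  assumes "f \<in> Arr C" "a \<in> Arr C" "u \<in> Arr C" "Dom C a = Dom C u" "Cod C a = Dom C f"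
    "Cod C f = X" "Cod C u = FObj T W" "W \<in> Obj C"
  shows "Strength T X W \<cdot> tuple C (f \<cdot> a) u
    = FMap T (tuple C (f \<cdot> Pr1 C (Dom C f) W) (Pr2 C (Dom C f) W)) \<cdot>
      Strength T (Dom C f) W \<cdot> tuple C a u"
proof -
  have obj: "X \<in> Obj C"
    using assms by auto
  have "Strength T X W \<cdot> prod_map C f (FMap T (Id C W))
    = FMap T (prod_map C f (Id C W)) \<cdot> Strength T (Dom C f) W"
    by (rule strength_natural) (use assms obj in \<open>simp_all add: hom_def\<close>)
  from arg_cong[OF this, of "\<lambda>m. m \<cdot> tuple C a u"] show ?thesis
    using assms obj by (simp add: prod_map_eq)
qed

lemma strength_tuple_assoc:
  assumes "a \<in> Arr C" "b \<in> Arr C" "u \<in> Arr C" "Dom C a = Dom C u" "Dom C b = Dom C u"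
    "Cod C a = X" "Cod C b = Y" "Cod C u = FObj T W" "W \<in> Obj C"
  shows "Strength T X (Prod C Y W) \<cdot> tuple C a (Strength T Y W \<cdot> tuple C b u)
    = FMap T (assoc C X Y W) \<cdot> Strength T (Prod C X Y) W \<cdot> tuple C (tuple C a b) u"
proof -
  have obj: "X \<in> Obj C" "Y \<in> Obj C"
    using assms by auto
  from arg_cong[OF strength_assoc[OF obj assms(9)], of "\<lambda>m. m \<cdot> tuple C (tuple C a b) u"]
  show ?thesis
    using assms obj by (simp add: prod_map_eq assoc_def)
qed

lemma strength_tuple_unit:
  assumes "a \<in> Arr C" "u \<in> Arr C" "Dom C a = Dom C u" "Cod C a = X" "Cod C u = W"
  shows "Strength T X W \<cdot> tuple C a (Unit T W \<cdot> u) = Unit T (Prod C X W) \<cdot> tuple C a u"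
proof -
  have obj: "X \<in> Obj C" "W \<in> Obj C"
    using assms by auto
  from arg_cong[OF strength_unit[OF obj], of "\<lambda>m. m \<cdot> tuple C a u"] show ?thesis
    using assms obj by (simp add: prod_map_eq)
qed

lemma strength_tuple_mult:
  assumes "a \<in> Arr C" "u \<in> Arr C" "Dom C a = Dom C u" "Cod C a = X"
    "Cod C u = FObj T (FObj T W)" "W \<in> Obj C"
  shows "Strength T X W \<cdot> tuple C a (Mult T W \<cdot> u)
    = Mult T (Prod C X W) \<cdot> FMap T (Strength T X W) \<cdot> Strength T X (FObj T W) \<cdot> tuple C a u"
proof -
  have obj: "X \<in> Obj C"
    using assms by auto
  from arg_cong[OF strength_mult[OF obj assms(6)], of "\<lambda>m. m \<cdot> tuple C a u"] show ?thesis
    using assms obj by (simp add: prod_map_eq)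
qed

text \<open>The axiom covers the parameter object \<open>One C\<close> only; naturality of the
  strength along the map from X to \<open>One C\<close> carries it to every X.\<close>

lemma strength_tuple_pr2:
  assumes "a \<in> Arr C" "u \<in> Arr C" "Dom C a = Dom C u" "Cod C a = X" "Cod C u = FObj T W"
    "W \<in> Obj C"
  shows "FMap T (Pr2 C X W) \<cdot> Strength T X W \<cdot> tuple C a u = u"
proof -
  have obj: "X \<in> Obj C"
    using assms by auto
  have "FMap T (Pr2 C (One C) W) \<cdot> Strength T (One C) W \<cdot> tuple C (to_one C X \<cdot> a) u
    = (FMap T (Pr2 C (One C) W) \<cdot> Strength T (One C) W) \<cdot> tuple C (to_one C X \<cdot> a) u"
    using assms obj by simp
  also have "\<dots> = u"
    using assms obj by (subst strength_one) simp_all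
  also have "FMap T (Pr2 C (One C) W) \<cdot> Strength T (One C) W \<cdot> tuple C (to_one C X \<cdot> a) u
    = FMap T (Pr2 C X W) \<cdot> Strength T X W \<cdot> tuple C a u"
    using assms obj by (simp add: strength_tuple_comp[of "to_one C X"])
  finally show ?thesis .
qed

section \<open>Laws of Kleisli extension with parameters\<close>

lemma bind_arr [simp]:
  assumes "k \<in> Arr C" "u \<in> Arr C" "Dom C k = Prod C (Dom C u) X" "Cod C k = FObj T Y"
    "Cod C u = FObj T X" "X \<in> Obj C" "Y \<in> Obj C"
  shows "bind C T X Y k u \<in> Arr C" "Dom C (bind C T X Y k u) = Dom C u"
    "Cod C (bind C T X Y k u) = FObj T Y"
  using assms by (simp_all add: bind_def)

text \<open>Change of stage. Naturality of the strength in its parameter moves h both into the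
  computation and into the parameter slot of the continuation.\<close>

lemma bind_comp:
  assumes "k \<in> Arr C" "u \<in> Arr C" "Dom C k = Prod C (Dom C u) X" "Cod C k = FObj T Y"
    "Cod C u = FObj T X" "X \<in> Obj C" "Y \<in> Obj C" "h \<in> Arr C" "Cod C h = Dom C u"
  shows "bind C T X Y k u \<cdot> h
    = bind C T X Y (k \<cdot> tuple C (h \<cdot> Pr1 C (Dom C h) X) (Pr2 C (Dom C h) X)) (u \<cdot> h)"
  using assms strength_tuple_comp[of h "Id C (Dom C h)" "u \<cdot> h" "Dom C u" X]
  by (simp add: bind_def)

lemma bind_unit:
  assumes "k \<in> Arr C" "x \<in> Arr C" "Dom C k = Prod C (Dom C x) X" "Cod C k = FObj T Y"
    "Cod C x = X" "Y \<in> Obj C"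
  shows "bind C T X Y k (Unit T X \<cdot> x) = k \<cdot> tuple C (Id C (Dom C x)) x"
  using assms by (auto simp: bind_def strength_tuple_unit)

text \<open>Associativity. On the right the inner bind lives over the stage extended by X, so k is
  weakened by a projection that hides X.\<close>

lemma bind_bind:
  assumes "k \<in> Arr C" "m \<in> Arr C" "u \<in> Arr C" "Dom C k = Prod C (Dom C u) Y"
    "Dom C m = Prod C (Dom C u) X" "Cod C k = FObj T Z" "Cod C m = FObj T Y"
    "Cod C u = FObj T X" "X \<in> Obj C" "Y \<in> Obj C" "Z \<in> Obj C" "P = Prod C (Dom C u) X"
  shows "bind C T Y Z k (bind C T X Y m u)
    = bind C T X Z
        (bind C T Y Z (k \<cdot> tuple C (Pr1 C (Dom C u) X \<cdot> Pr1 C P Y) (Pr2 C P Y)) m) u"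
  \<comment> \<open>The two instances move the strength past the diagonal on the parameter, which
    arises because both binds read it, and past the projection that hides X from k.\<close>
  using assms strength_tuple_comp[of "tuple C (Id C (Dom C u)) (Id C (Dom C u))" "Id C (Dom C u)" u _ X]
    strength_tuple_comp[of "Pr1 C (Dom C u) X" "Id C P" m "Dom C u" Y]
  by (simp add: bind_def strength_tuple_mult strength_tuple_fmap strength_tuple_assoc assoc_def)

text \<open>Together with \<open>bind_mult_fmap\<close> this presents the remaining term formers as
  binds whose continuation ignores the stage, so that closure under \<open>bind\<close> covers
  them.\<close>

lemma bind_fmap:
  assumes "f \<in> Arr C" "u \<in> Arr C" "Dom C f = X" "Cod C f = Y" "Cod C u = FObj T X"
  shows "bind C T X Y (Unit T Y \<cdot> f \<cdot> Pr2 C (Dom C u) X) u = FMap T f \<cdot> u"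
proof -
  have obj: "X \<in> Obj C" "Y \<in> Obj C"
    using assms by auto
  have "bind C T X Y (Unit T Y \<cdot> f \<cdot> Pr2 C (Dom C u) X) u
    = FMap T f \<cdot> FMap T (Pr2 C (Dom C u) X) \<cdot> Strength T (Dom C u) X \<cdot> tuple C (Id C (Dom C u)) u"
    using assms obj by (simp add: bind_def)
  \<comment> \<open>Merging is switched off here: \<open>strength_tuple_pr2\<close> needs the image
    of the projection right next to the strength.\<close>
  then show ?thesis
    using assms obj by (simp add: strength_tuple_pr2 del: fmap_fmap_comp)
qed

lemma bind_mult_fmap:
  assumes "f \<in> Arr C" "u \<in> Arr C" "Dom C f = X" "Cod C f = FObj T Y" "Cod C u = FObj T X"
    "Y \<in> Obj C"
  shows "bind C T X Y (f \<cdot> Pr2 C (Dom C u) X) u = Mult T Y \<cdot> FMap T f \<cdot> u"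
proof -
  have obj: "X \<in> Obj C"
    using assms by auto
  have "bind C T X Y (f \<cdot> Pr2 C (Dom C u) X) u
    = Mult T Y \<cdot> FMap T f \<cdot> FMap T (Pr2 C (Dom C u) X) \<cdot>
      Strength T (Dom C u) X \<cdot> tuple C (Id C (Dom C u)) u"
    using assms obj by (simp add: bind_def)
  then show ?thesis
    using assms obj by (simp add: strength_tuple_pr2 del: fmap_fmap_comp)
qed

lemma right_strength_arr [simp]:
  assumes "X \<in> Obj C" "W \<in> Obj C"
  shows "right_strength C T W X \<in> Arr C" "Dom C (right_strength C T W X) = Prod C (FObj T W) X"
    "Cod C (right_strength C T W X) = FObj T (Prod C W X)"
  using assms by (simp_all add: right_strength_def swap_def)

lemma st_both_arr [simp]:
  assumes "X \<in> Obj C" "Y \<in> Obj C"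
  shows "st_both C T X Y \<in> Arr C" "Dom C (st_both C T X Y) = Prod C (FObj T X) (FObj T Y)"
    "Cod C (st_both C T X Y) = FObj T (FObj T (Prod C X Y))"
  using assms by (simp_all add: st_both_def)

text \<open>After the swap in the right strength, v sits in the parameter slot; naturality replaces
  it there by the stage W. Pairing thus becomes two nested binds, u before v.\<close>

lemma mult_st_both:
  assumes "u \<in> Arr C" "v \<in> Arr C" "Dom C u = W" "Dom C v = W"
    "Cod C u = FObj T X" "Cod C v = FObj T Y" "X \<in> Obj C" "Y \<in> Obj C" "P = Prod C W X"
  shows "Mult T (Prod C X Y) \<cdot> st_both C T X Y \<cdot> tuple C u v
    = bind C T X (Prod C X Y) (bind C T Y (Prod C X Y)
        (Unit T (Prod C X Y) \<cdot> tuple C (Pr2 C W X \<cdot> Pr1 C P Y) (Pr2 C P Y)) (v \<cdot> Pr1 C W X)) u"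
proof -
  have obj: "W \<in> Obj C"
    using assms by auto
  show ?thesis
    using assms obj strength_tuple_comp[of v "Id C W" u "FObj T Y" X]
      strength_tuple_comp[of "Pr2 C W X" "Id C P" "v \<cdot> Pr1 C W X" X Y]
    by (simp add: bind_def st_both_def right_strength_def swap_def)
qed

end


section \<open>Kripke relations indexed by the objects of a category\<close>

type_synonym ('o, 'm) krel = "'o \<Rightarrow> 'm \<Rightarrow> 'm \<Rightarrow> bool"

text \<open>In other words, a subpresheaf of the product of the representables at X and Y.\<close>

definition kripke :: "('o, 'm, 'z) category_scheme \<Rightarrow> 'o \<Rightarrow> 'o \<Rightarrow> ('o, 'm) krel \<Rightarrow> bool" where
  "kripke C X Y P \<longleftrightarrow> X \<in> Obj C \<and> Y \<in> Obj C \<and>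
     (\<forall>Z x y. P Z x y \<longrightarrow> x \<in> hom C Z X \<and> y \<in> hom C Z Y) \<and>
     (\<forall>Z W x y h. P Z x y \<longrightarrow> h \<in> hom C W Z \<longrightarrow> P W (x \<cdot>\<^bsub>C\<^esub> h) (y \<cdot>\<^bsub>C\<^esub> h))"

text \<open>Density says that a map out of \<open>W \<times> X\<close> is determined by its values on the generalized
  elements that are related to themselves. The naive sum relation below relates only maps that
  factor through a coprojection, but density is still inherited by sums.\<close>

definition dense :: "('o, 'm, 'z) biccc_scheme \<Rightarrow> 'o \<Rightarrow> ('o, 'm) krel \<Rightarrow> bool" where
  "dense C X P \<longleftrightarrow> (\<forall>W Y k l. W \<in> Obj C \<longrightarrow> k \<in> hom C (Prod C W X) Y \<longrightarrow> l \<in> hom C (Prod C W X) Y \<longrightarrow>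
     (\<forall>V j x. j \<in> hom C V W \<longrightarrow> P V x x \<longrightarrow> k \<cdot>\<^bsub>C\<^esub> tuple C j x = l \<cdot>\<^bsub>C\<^esub> tuple C j x) \<longrightarrow> k = l)"

text \<open>The substitute for equality at ground types: possibly smaller than the diagonal, but
  large enough to separate maps.\<close>

definition sub_diagonal ::
  "('o, 'm, 'z) biccc_scheme \<Rightarrow> 'o \<Rightarrow> ('o, 'm) krel \<Rightarrow> bool" where
  "sub_diagonal C X P \<longleftrightarrow> kripke C X X P \<and> (\<forall>Z x y. P Z x y \<longrightarrow> x = y) \<and> dense C X P"

definition eq_rel :: "('o, 'm, 'z) biccc_scheme \<Rightarrow> 'o \<Rightarrow> ('o, 'm) krel" where
  "eq_rel C X Z f g \<longleftrightarrow> f \<in> hom C Z X \<and> f = g"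

definition prod_rel :: "('o, 'm, 'z) biccc_scheme \<Rightarrow> 'o \<Rightarrow> 'o \<Rightarrow> 'o \<Rightarrow> 'o \<Rightarrow>
    ('o, 'm) krel \<Rightarrow> ('o, 'm) krel \<Rightarrow> ('o, 'm) krel" where
  "prod_rel C X Y X' Y' P Q Z f g \<longleftrightarrow> f \<in> hom C Z (Prod C X X') \<and> g \<in> hom C Z (Prod C Y Y') \<and>
     P Z (Pr1 C X X' \<cdot>\<^bsub>C\<^esub> f) (Pr1 C Y Y' \<cdot>\<^bsub>C\<^esub> g) \<and> Q Z (Pr2 C X X' \<cdot>\<^bsub>C\<^esub> f) (Pr2 C Y Y' \<cdot>\<^bsub>C\<^esub> g)"

definition sum_rel :: "('o, 'm, 'z) biccc_scheme \<Rightarrow> 'o \<Rightarrow> 'o \<Rightarrow> 'o \<Rightarrow> 'o \<Rightarrow>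
    ('o, 'm) krel \<Rightarrow> ('o, 'm) krel \<Rightarrow> ('o, 'm) krel" where
  "sum_rel C X Y X' Y' P Q Z f g \<longleftrightarrow>
     (\<exists>x y. P Z x y \<and> f = In1 C X X' \<cdot>\<^bsub>C\<^esub> x \<and> g = In1 C Y Y' \<cdot>\<^bsub>C\<^esub> y) \<or>
     (\<exists>x y. Q Z x y \<and> f = In2 C X X' \<cdot>\<^bsub>C\<^esub> x \<and> g = In2 C Y Y' \<cdot>\<^bsub>C\<^esub> y)"

text \<open>The nullary case of \<open>sum_rel\<close>: no summand to factor through, hence nothing
  is related, not even at the stage \<open>Zero C\<close>.\<close>

definition empty_rel :: "('o, 'm) krel" where
  "empty_rel Z f g \<longleftrightarrow> False"

lemma kripkeD:
  assumes "kripke C X Y P"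
  shows "X \<in> Obj C" "Y \<in> Obj C"
    and "P Z x y \<Longrightarrow> x \<in> Arr C \<and> Dom C x = Z \<and> Cod C x = X \<and> y \<in> Arr C \<and> Dom C y = Z \<and> Cod C y = Y"
    and "\<lbrakk>P Z x y; h \<in> Arr C; Cod C h = Z\<rbrakk> \<Longrightarrow> P (Dom C h) (x \<cdot>\<^bsub>C\<^esub> h) (y \<cdot>\<^bsub>C\<^esub> h)"
  using assms unfolding kripke_def hom_def by blast+

lemma sub_diagonalD:
  assumes "sub_diagonal C X P"
  shows "kripke C X X P" "P Z x y \<Longrightarrow> x = y" "dense C X P"
  using assms unfolding sub_diagonal_def by blast+

lemma denseD:
  assumes "dense C X P" "k \<in> Arr C" "l \<in> Arr C" "Dom C k = Prod C W X" "Dom C l = Prod C W X"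
    "Cod C k = Cod C l" "W \<in> Obj C"
    "\<And>V j x. \<lbrakk>j \<in> Arr C; Dom C j = V; Cod C j = W; P V x x\<rbrakk>
      \<Longrightarrow> k \<cdot>\<^bsub>C\<^esub> tuple C j x = l \<cdot>\<^bsub>C\<^esub> tuple C j x"
  shows "k = l"
  using assms unfolding dense_def hom_def by blast

lemma denseI:
  assumes "\<And>W Y k l. \<lbrakk>W \<in> Obj C; k \<in> Arr C; l \<in> Arr C; Dom C k = Prod C W X; Dom C l = Prod C W X;
      Cod C k = Y; Cod C l = Y;
      \<And>V j x. \<lbrakk>j \<in> Arr C; Dom C j = V; Cod C j = W; P V x x\<rbrakk>
        \<Longrightarrow> k \<cdot>\<^bsub>C\<^esub> tuple C j x = l \<cdot>\<^bsub>C\<^esub> tuple C j x\<rbrakk> \<Longrightarrow> k = l"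
  shows "dense C X P"
  unfolding dense_def hom_def by (intro allI impI, rule assms) auto

context biccc
begin

section \<open>Equality and the empty relation\<close>

lemma kripke_eq_rel: "X \<in> Obj C \<Longrightarrow> kripke C X X (eq_rel C X)"
  by (auto simp: kripke_def eq_rel_def hom_def)

lemma sub_diagonal_eq_rel:
  assumes "X \<in> Obj C"
  shows "sub_diagonal C X (eq_rel C X)"
  unfolding sub_diagonal_def
proof (intro conjI)
  show "dense C X (eq_rel C X)"
  proof (rule denseI)
    fix W Y k l
    assume *: "W \<in> Obj C" "k \<in> Arr C" "l \<in> Arr C" "Dom C k = Prod C W X" "Dom C l = Prod C W X"
      and eq: "\<And>V j x. \<lbrakk>j \<in> Arr C; Dom C j = V; Cod C j = W; eq_rel C X V x x\<rbrakk>
        \<Longrightarrow> k \<cdot> tuple C j x = l \<cdot> tuple C j x"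
    \<comment> \<open>The generic element: at stage \<open>Prod C W X\<close> the two projections
      pair to the identity.\<close>
    have "k \<cdot> tuple C (Pr1 C W X) (Pr2 C W X) = l \<cdot> tuple C (Pr1 C W X) (Pr2 C W X)"
      by (rule eq) (use * assms in \<open>auto simp: eq_rel_def hom_def\<close>)
    then show "k = l"
      using * assms by simp
  qed
qed (use assms kripke_eq_rel in \<open>auto simp: eq_rel_def\<close>)

lemma kripke_empty_rel: "\<lbrakk>X \<in> Obj C; Y \<in> Obj C\<rbrakk> \<Longrightarrow> kripke C X Y empty_rel"
  by (simp add: kripke_def empty_rel_def)

text \<open>With no related elements the premise of density is vacuous, so all parallel maps out of
  the product of W with \<open>Zero C\<close> must coincide, which cartesian closure
  ensures.\<close>

lemma sub_diagonal_empty_rel: "sub_diagonal C (Zero C) empty_rel"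
  unfolding sub_diagonal_def
proof (intro conjI)
  show "dense C (Zero C) empty_rel"
    by (rule denseI) (rule prod_zero_eq, auto)
qed (auto simp: kripke_empty_rel empty_rel_def)

section \<open>Products of relations\<close>

lemma kripke_prod_rel:
  assumes "kripke C X Y P" "kripke C X' Y' Q"
  shows "kripke C (Prod C X X') (Prod C Y Y') (prod_rel C X Y X' Y' P Q)"
proof -
  note [simp] = kripkeD(1,2)[OF assms(1)] kripkeD(1,2)[OF assms(2)]
  show ?thesis
    unfolding kripke_def
  proof (intro conjI allI impI)
    fix Z W f g h
    assume r: "prod_rel C X Y X' Y' P Q Z f g" and h: "h \<in> hom C W Z"
    then have "P W ((Pr1 C X X' \<cdot> f) \<cdot> h) ((Pr1 C Y Y' \<cdot> g) \<cdot> h)"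
      "Q W ((Pr2 C X X' \<cdot> f) \<cdot> h) ((Pr2 C Y Y' \<cdot> g) \<cdot> h)"
      using kripkeD(4)[OF assms(1), of Z _ _ h] kripkeD(4)[OF assms(2), of Z _ _ h]
      unfolding prod_rel_def hom_def by blast+
    then show "prod_rel C X Y X' Y' P Q W (f \<cdot> h) (g \<cdot> h)"
      using r h by (simp add: prod_rel_def hom_def)
  qed (simp_all add: prod_rel_def)
qed

lemma prod_rel_tuple:
  assumes "kripke C X Y P" "kripke C X' Y' Q" "P Z x y" "Q Z x' y'"
  shows "prod_rel C X Y X' Y' P Q Z (tuple C x x') (tuple C y y')"
  using kripkeD(3)[OF assms(1,3)] kripkeD(3)[OF assms(2,4)] assms(3,4)
  by (simp add: prod_rel_def hom_def)

text \<open>Density is applied one factor at a time. This is why its definition has a parameter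
  object: the parameter absorbs the factor that is not being tested.\<close>

lemma sub_diagonal_prod_rel:
  assumes P: "sub_diagonal C X P" and Q: "sub_diagonal C Y Q"
  shows "sub_diagonal C (Prod C X Y) (prod_rel C X X Y Y P Q)"
  unfolding sub_diagonal_def
proof (intro conjI allI impI)
  note kP = sub_diagonalD(1)[OF P] and kQ = sub_diagonalD(1)[OF Q]
  note [simp] = kripkeD(1)[OF kP] kripkeD(1)[OF kQ]
  show "kripke C (Prod C X Y) (Prod C X Y) (prod_rel C X X Y Y P Q)"
    by (rule kripke_prod_rel[OF kP kQ])
  show "f = g" if "prod_rel C X X Y Y P Q Z f g" for Z f g
    by (rule tuple_eqI[where X = X and Y = Y])
      (use that sub_diagonalD(2)[OF P] sub_diagonalD(2)[OF Q] in \<open>auto simp: prod_rel_def hom_def\<close>)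
  show "dense C (Prod C X Y) (prod_rel C X X Y Y P Q)"
  proof (rule denseI)
    fix W Z k l
    assume [simp]: "W \<in> Obj C" "k \<in> Arr C" "l \<in> Arr C" "Dom C k = Prod C W (Prod C X Y)"
      "Dom C l = Prod C W (Prod C X Y)" "Cod C k = Z" "Cod C l = Z"
    assume eq: "\<And>V j x. \<lbrakk>j \<in> Arr C; Dom C j = V; Cod C j = W; prod_rel C X X Y Y P Q V x x\<rbrakk>
        \<Longrightarrow> k \<cdot> tuple C j x = l \<cdot> tuple C j x"
    let ?WX = "Prod C W X"
    \<comment> \<open>Reassociation, making Y the tested factor and X part of the parameter.\<close>
    define s where "s = tuple C (Pr1 C W X \<cdot> Pr1 C ?WX Y) (tuple C (Pr2 C W X \<cdot> Pr1 C ?WX Y) (Pr2 C ?WX Y))"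
    have [simp]: "s \<in> Arr C" "Dom C s = Prod C ?WX Y" "Cod C s = Prod C W (Prod C X Y)"
      by (simp_all add: s_def)
    have "k \<cdot> s = l \<cdot> s"
    proof (rule denseD[OF sub_diagonalD(3)[OF Q], where W = ?WX])
      fix V j y
      assume [simp]: "j \<in> Arr C" "Dom C j = V" "Cod C j = ?WX" and y: "Q V y y"
      note [simp] = kripkeD(3)[OF kQ y]
      have [simp]: "V \<in> Obj C"
        using dom_obj[of j] by simp
      \<comment> \<open>Now y is fixed and the X-component of j is replaced by a free variable, to
        be tested by the density of P over the stage V.\<close>
      define r where "r = tuple C (Pr1 C W X \<cdot> j \<cdot> Pr1 C V X) (tuple C (Pr2 C V X) (y \<cdot> Pr1 C V X))"
      have [simp]: "r \<in> Arr C" "Dom C r = Prod C V X" "Cod C r = Prod C W (Prod C X Y)"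
        by (simp_all add: r_def)
      have "k \<cdot> r = l \<cdot> r"
      proof (rule denseD[OF sub_diagonalD(3)[OF P], where W = V])
        fix V' i x
        assume [simp]: "i \<in> Arr C" "Dom C i = V'" "Cod C i = V" and x: "P V' x x"
        note [simp] = kripkeD(3)[OF kP x]
        have "Q V' (y \<cdot> i) (y \<cdot> i)"
          using kripkeD(4)[OF kQ y, of i] by simp
        then have "k \<cdot> tuple C (Pr1 C W X \<cdot> j \<cdot> i) (tuple C x (y \<cdot> i))
          = l \<cdot> tuple C (Pr1 C W X \<cdot> j \<cdot> i) (tuple C x (y \<cdot> i))"
          by (intro eq[of _ V'] prod_rel_tuple[OF kP kQ] x) simp_all
        then show "(k \<cdot> r) \<cdot> tuple C i x = (l \<cdot> r) \<cdot> tuple C i x"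
          by (simp add: r_def)
      qed simp_all
      \<comment> \<open>Substituting the X-component of j for the free variable turns r into s at
        the pair of j and y.\<close>
      from arg_cong[OF this, of "\<lambda>m. m \<cdot> tuple C (Id C V) (Pr2 C W X \<cdot> j)"]
      show "(k \<cdot> s) \<cdot> tuple C j y = (l \<cdot> s) \<cdot> tuple C j y"
        by (simp add: r_def s_def)
    qed simp_all
    \<comment> \<open>The inverse reassociation cancels s.\<close>
    from arg_cong[OF this, of "\<lambda>m. m \<cdot> tuple C (tuple C (Pr1 C W (Prod C X Y))
        (Pr1 C X Y \<cdot> Pr2 C W (Prod C X Y))) (Pr2 C X Y \<cdot> Pr2 C W (Prod C X Y))"]
    show "k = l"
      by (simp add: s_def)
  qed
qed

section \<open>Sums of relations\<close>

lemma kripke_sum_rel: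
  assumes "kripke C X Y P" "kripke C X' Y' Q"
  shows "kripke C (Sum C X X') (Sum C Y Y') (sum_rel C X Y X' Y' P Q)"
proof -
  note [simp] = kripkeD(1,2)[OF assms(1)] kripkeD(1,2)[OF assms(2)]
  show ?thesis
    unfolding kripke_def
  proof (intro conjI allI impI)
    fix Z f g
    assume r: "sum_rel C X Y X' Y' P Q Z f g"
    then show "f \<in> hom C Z (Sum C X X')" "g \<in> hom C Z (Sum C Y Y')"
      unfolding sum_rel_def
      by (auto simp: hom_def dest: kripkeD(3)[OF assms(1)] kripkeD(3)[OF assms(2)])
    fix W h
    assume h: "h \<in> hom C W Z"
    consider x y where "P Z x y" "f = In1 C X X' \<cdot> x" "g = In1 C Y Y' \<cdot> y"
      | x y where "Q Z x y" "f = In2 C X X' \<cdot> x" "g = In2 C Y Y' \<cdot> y"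
      using r unfolding sum_rel_def by blast
    then show "sum_rel C X Y X' Y' P Q W (f \<cdot> h) (g \<cdot> h)"
    proof cases
      case 1
      then show ?thesis
        using kripkeD(3)[OF assms(1) 1(1)] kripkeD(4)[OF assms(1) 1(1), of h] h
        unfolding sum_rel_def by (intro disjI1 exI[of _ "x \<cdot> h"] exI[of _ "y \<cdot> h"]) (auto simp: hom_def)
    next
      case 2
      then show ?thesis
        using kripkeD(3)[OF assms(2) 2(1)] kripkeD(4)[OF assms(2) 2(1), of h] h
        unfolding sum_rel_def by (intro disjI2 exI[of _ "x \<cdot> h"] exI[of _ "y \<cdot> h"]) (auto simp: hom_def)
    qed
  qed simp_all
qed

text \<open>By distributivity a map out of the product of W with a sum is determined by its
  restrictions to the two summands, and each restriction is tested by the density of its own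
  relation.\<close>

lemma sub_diagonal_sum_rel:
  assumes P: "sub_diagonal C X P" and Q: "sub_diagonal C Y Q"
  shows "sub_diagonal C (Sum C X Y) (sum_rel C X X Y Y P Q)"
  unfolding sub_diagonal_def
proof (intro conjI allI impI)
  note kP = sub_diagonalD(1)[OF P] and kQ = sub_diagonalD(1)[OF Q]
  note [simp] = kripkeD(1)[OF kP] kripkeD(1)[OF kQ]
  show "kripke C (Sum C X Y) (Sum C X Y) (sum_rel C X X Y Y P Q)"
    by (rule kripke_sum_rel[OF kP kQ])
  show "f = g" if "sum_rel C X X Y Y P Q Z f g" for Z f g
    using that sub_diagonalD(2)[OF P] sub_diagonalD(2)[OF Q] unfolding sum_rel_def by blast
  show "dense C (Sum C X Y) (sum_rel C X X Y Y P Q)"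
  proof (rule denseI)
    fix W Z k l
    assume [simp]: "W \<in> Obj C" "k \<in> Arr C" "l \<in> Arr C" "Dom C k = Prod C W (Sum C X Y)"
      "Dom C l = Prod C W (Sum C X Y)" "Cod C k = Z" "Cod C l = Z"
    assume eq: "\<And>V j x. \<lbrakk>j \<in> Arr C; Dom C j = V; Cod C j = W; sum_rel C X X Y Y P Q V x x\<rbrakk>
        \<Longrightarrow> k \<cdot> tuple C j x = l \<cdot> tuple C j x"
    show "k = l"
    proof (rule prod_sum_eqI)
      show "k \<cdot> tuple C (Pr1 C W X) (In1 C X Y \<cdot> Pr2 C W X)
        = l \<cdot> tuple C (Pr1 C W X) (In1 C X Y \<cdot> Pr2 C W X)"
      proof (rule denseD[OF sub_diagonalD(3)[OF P], where W = W])
        fix V j x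
        assume [simp]: "j \<in> Arr C" "Dom C j = V" "Cod C j = W" and x: "P V x x"
        note [simp] = kripkeD(3)[OF kP x]
        have "sum_rel C X X Y Y P Q V (In1 C X Y \<cdot> x) (In1 C X Y \<cdot> x)"
          using x unfolding sum_rel_def by blast
        then show "(k \<cdot> tuple C (Pr1 C W X) (In1 C X Y \<cdot> Pr2 C W X)) \<cdot> tuple C j x
          = (l \<cdot> tuple C (Pr1 C W X) (In1 C X Y \<cdot> Pr2 C W X)) \<cdot> tuple C j x"
          using eq[of j V] by simp
      qed simp_all
      show "k \<cdot> tuple C (Pr1 C W Y) (In2 C X Y \<cdot> Pr2 C W Y)
        = l \<cdot> tuple C (Pr1 C W Y) (In2 C X Y \<cdot> Pr2 C W Y)"
      proof (rule denseD[OF sub_diagonalD(3)[OF Q], where W = W])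
        fix V j x
        assume [simp]: "j \<in> Arr C" "Dom C j = V" "Cod C j = W" and x: "Q V x x"
        note [simp] = kripkeD(3)[OF kQ x]
        have "sum_rel C X X Y Y P Q V (In2 C X Y \<cdot> x) (In2 C X Y \<cdot> x)"
          using x unfolding sum_rel_def by blast
        then show "(k \<cdot> tuple C (Pr1 C W Y) (In2 C X Y \<cdot> Pr2 C W Y)) \<cdot> tuple C j x
          = (l \<cdot> tuple C (Pr1 C W Y) (In2 C X Y \<cdot> Pr2 C W Y)) \<cdot> tuple C j x"
          using eq[of j V] by simp
      qed simp_all
    qed simp_all
  qed
qed

end


section \<open>Relational lifting along a strong monad morphism\<close>

context strong_monad_morphism
begin

section \<open>Compatibility of \<alpha> with Kleisli extension\<close>

lemma component_arr [simp]:
  assumes "X \<in> Obj C"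
  shows "\<alpha> X \<in> Arr C" "Dom C (\<alpha> X) = FObj T X" "Cod C (\<alpha> X) = FObj U X"
  using component_hom[OF assms] by (auto simp: hom_def)

lemma component_fmap:
  "\<lbrakk>f \<in> Arr C; Dom C f = X; Cod C f = Y\<rbrakk> \<Longrightarrow> \<alpha> Y \<cdot> FMap T f = FMap U f \<cdot> \<alpha> X"
  using natural[of f X Y] by (auto simp: hom_def)

lemma component_fmap_comp:
  "\<lbrakk>f \<in> Arr C; Dom C f = X; Cod C f = Y; h \<in> Arr C; Cod C h = FObj T X\<rbrakk>
    \<Longrightarrow> \<alpha> Y \<cdot> FMap T f \<cdot> h = FMap U f \<cdot> \<alpha> X \<cdot> h"
  using T.comp_assoc_arr[of h "FMap T f" "\<alpha> Y"] by (auto simp: component_fmap)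

lemma component_unit_comp:
  "\<lbrakk>X \<in> Obj C; h \<in> Arr C; Cod C h = X\<rbrakk> \<Longrightarrow> \<alpha> X \<cdot> Unit T X \<cdot> h = Unit U X \<cdot> h"
  using T.comp_assoc_arr[of h "Unit T X" "\<alpha> X"] by (simp add: preserves_unit)

lemma component_mult_comp:
  assumes "X \<in> Obj C" "h \<in> Arr C" "Cod C h = FObj T (FObj T X)"
  shows "\<alpha> X \<cdot> Mult T X \<cdot> h = Mult U X \<cdot> FMap U (\<alpha> X) \<cdot> \<alpha> (FObj T X) \<cdot> h"
proof -
  have "\<alpha> X \<cdot> Mult T X \<cdot> h = (\<alpha> X \<cdot> Mult T X) \<cdot> h"
    using assms by simp
  also have "\<dots> = (Mult U X \<cdot> FMap U (\<alpha> X) \<cdot> \<alpha> (FObj T X)) \<cdot> h"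
    using assms by (subst preserves_mult) simp_all
  finally show ?thesis
    using assms by simp
qed

lemma component_strength_tuple:
  assumes "a \<in> Arr C" "u \<in> Arr C" "Dom C a = Dom C u" "Cod C a = X" "Cod C u = FObj T Y"
    "Y \<in> Obj C"
  shows "\<alpha> (Prod C X Y) \<cdot> Strength T X Y \<cdot> tuple C a u = Strength U X Y \<cdot> tuple C a (\<alpha> Y \<cdot> u)"
proof -
  have obj: "X \<in> Obj C"
    using assms by auto
  from arg_cong[OF preserves_strength[OF obj assms(6)], of "\<lambda>m. m \<cdot> tuple C a u"] show ?thesis
    using assms obj by (simp add: T.prod_map_eq)
qed

text \<open>Naturality, multiplication and strength combined: \<alpha> is a homomorphism for
  parametrised \<open>bind\<close>.\<close>

lemma component_bind:
  assumes "k \<in> Arr C" "u \<in> Arr C" "Dom C k = Prod C (Dom C u) X" "Cod C k = FObj T Y"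
    "Cod C u = FObj T X" "X \<in> Obj C" "Y \<in> Obj C"
  shows "\<alpha> Y \<cdot> bind C T X Y k u = bind C U X Y (\<alpha> Y \<cdot> k) (\<alpha> X \<cdot> u)"
proof -
  have "\<alpha> Y \<cdot> bind C T X Y k u
    = Mult U Y \<cdot> FMap U (\<alpha> Y \<cdot> k) \<cdot> \<alpha> (Prod C (Dom C u) X) \<cdot>
      Strength T (Dom C u) X \<cdot> tuple C (Id C (Dom C u)) u"
    using assms by (simp add: bind_def component_mult_comp component_fmap_comp)
  also have "\<dots> = bind C U X Y (\<alpha> Y \<cdot> k) (\<alpha> X \<cdot> u)"
    using assms by (simp add: bind_def component_strength_tuple)
  finally show ?thesis .
qed

text \<open>The \<open>\<top>\<top>\<close>-lifting of \<open>P\<close> along \<open>\<alpha>\<close>.\<close>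

definition lift_rel :: "'o \<Rightarrow> 'o \<Rightarrow> ('o, 'm) krel \<Rightarrow> ('o, 'm) krel" where
  "lift_rel X Y P Z u v \<longleftrightarrow> u \<in> hom C Z (FObj T X) \<and> v \<in> hom C Z (FObj U Y) \<and>
     (\<forall>W G h k l. h \<in> hom C W Z \<longrightarrow> G \<in> Obj C \<longrightarrow>
        k \<in> hom C (Prod C W X) (FObj T G) \<longrightarrow> l \<in> hom C (Prod C W Y) (FObj U G) \<longrightarrow>
        (\<forall>V j x y. j \<in> hom C V W \<longrightarrow> P V x y \<longrightarrow> \<alpha> G \<cdot> k \<cdot> tuple C j x = l \<cdot> tuple C j y) \<longrightarrow>
        \<alpha> G \<cdot> bind C T X G k (u \<cdot> h) = bind C U Y G l (v \<cdot> h))"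

lemma lift_relI:
  assumes "u \<in> Arr C" "Dom C u = Z" "Cod C u = FObj T X" "v \<in> Arr C" "Dom C v = Z"
    "Cod C v = FObj U Y"
    "\<And>W G h k l. \<lbrakk>h \<in> Arr C; Dom C h = W; Cod C h = Z; G \<in> Obj C; k \<in> Arr C; l \<in> Arr C;
      Dom C k = Prod C W X; Dom C l = Prod C W Y; Cod C k = FObj T G; Cod C l = FObj U G;
      \<And>V j x y. \<lbrakk>j \<in> Arr C; Dom C j = V; Cod C j = W; P V x y\<rbrakk>
        \<Longrightarrow> \<alpha> G \<cdot> k \<cdot> tuple C j x = l \<cdot> tuple C j y\<rbrakk>
      \<Longrightarrow> \<alpha> G \<cdot> bind C T X G k (u \<cdot> h) = bind C U Y G l (v \<cdot> h)"
  shows "lift_rel X Y P Z u v"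
  unfolding lift_rel_def
proof (intro conjI allI impI)
  show "u \<in> hom C Z (FObj T X)" "v \<in> hom C Z (FObj U Y)"
    using assms(1-6) by (simp_all add: hom_def)
  fix W G h k l
  assume "h \<in> hom C W Z" "G \<in> Obj C" "k \<in> hom C (Prod C W X) (FObj T G)"
    "l \<in> hom C (Prod C W Y) (FObj U G)"
    "\<forall>V j x y. j \<in> hom C V W \<longrightarrow> P V x y \<longrightarrow> \<alpha> G \<cdot> k \<cdot> tuple C j x = l \<cdot> tuple C j y"
  then show "\<alpha> G \<cdot> bind C T X G k (u \<cdot> h) = bind C U Y G l (v \<cdot> h)"
    by (intro assms(7)[of h W]) (auto simp: hom_def)
qed

lemma lift_relD:
  assumes "lift_rel X Y P Z u v"
  shows "u \<in> Arr C" "Dom C u = Z" "Cod C u = FObj T X" "v \<in> Arr C" "Dom C v = Z"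
    "Cod C v = FObj U Y"
    and "\<lbrakk>h \<in> Arr C; Dom C h = W; Cod C h = Z; G \<in> Obj C; k \<in> Arr C; l \<in> Arr C;
      Dom C k = Prod C W X; Dom C l = Prod C W Y; Cod C k = FObj T G; Cod C l = FObj U G;
      \<And>V j x y. \<lbrakk>j \<in> Arr C; Dom C j = V; Cod C j = W; P V x y\<rbrakk>
        \<Longrightarrow> \<alpha> G \<cdot> k \<cdot> tuple C j x = l \<cdot> tuple C j y\<rbrakk>
      \<Longrightarrow> \<alpha> G \<cdot> bind C T X G k (u \<cdot> h) = bind C U Y G l (v \<cdot> h)"
  using assms unfolding lift_rel_def hom_def by blast+

section \<open>Closure properties of the lifting\<close>

lemma lift_rel_comp:
  assumes "lift_rel X Y P Z u v" "h \<in> Arr C" "Dom C h = W" "Cod C h = Z"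
  shows "lift_rel X Y P W (u \<cdot> h) (v \<cdot> h)"
proof -
  note [simp] = lift_relD(1-6)[OF assms(1)] assms(2-4)
  show ?thesis
    by (rule lift_relI) (simp_all add: lift_relD(7)[OF assms(1)])
qed

text \<open>Binding a unit is substitution, so the test reduces to agreement of the two
  continuations at the related values, restricted to the stage of the test.\<close>

lemma lift_rel_unit:
  assumes P: "kripke C X Y P" and r: "P Z x y"
  shows "lift_rel X Y P Z (Unit T X \<cdot> x) (Unit U Y \<cdot> y)"
proof -
  note [simp] = kripkeD(1,2)[OF P] kripkeD(3)[OF P r]
  show ?thesis
  proof (rule lift_relI)
    fix W G h k l
    assume [simp]: "h \<in> Arr C" "Dom C h = W" "Cod C h = Z" "G \<in> Obj C" "k \<in> Arr C" "l \<in> Arr C"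
      "Dom C k = Prod C W X" "Dom C l = Prod C W Y" "Cod C k = FObj T G" "Cod C l = FObj U G"
    assume eq: "\<And>V j x y. \<lbrakk>j \<in> Arr C; Dom C j = V; Cod C j = W; P V x y\<rbrakk>
        \<Longrightarrow> \<alpha> G \<cdot> k \<cdot> tuple C j x = l \<cdot> tuple C j y"
    have [simp]: "W \<in> Obj C"
      using T.dom_obj[of h] by simp
    have "P W (x \<cdot> h) (y \<cdot> h)"
      using kripkeD(4)[OF P r, of h] by simp
    then show "\<alpha> G \<cdot> bind C T X G k ((Unit T X \<cdot> x) \<cdot> h) = bind C U Y G l ((Unit U Y \<cdot> y) \<cdot> h)"
      using eq[of "Id C W" W] by (simp add: T.bind_unit U.bind_unit)
  qed simp_all
qed

text \<open>By associativity, testing a bind with k amounts to testing u with "m, then k". That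
  composite is an admissible continuation because m and n send related values to lifted
  computations.\<close>

lemma lift_rel_bind:
  assumes r: "lift_rel X Y P Z u v" and P: "kripke C X Y P" and Q: "kripke C X' Y' Q"
    and m: "m \<in> Arr C" "Dom C m = Prod C Z X" "Cod C m = FObj T X'"
    and n: "n \<in> Arr C" "Dom C n = Prod C Z Y" "Cod C n = FObj U Y'"
    and mn: "\<And>V j x y. \<lbrakk>j \<in> Arr C; Dom C j = V; Cod C j = Z; P V x y\<rbrakk>
      \<Longrightarrow> lift_rel X' Y' Q V (m \<cdot> tuple C j x) (n \<cdot> tuple C j y)"
  shows "lift_rel X' Y' Q Z (bind C T X X' m u) (bind C U Y Y' n v)"
proof -
  note [simp] = kripkeD(1,2)[OF P] kripkeD(1,2)[OF Q] lift_relD(1-6)[OF r] m n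
  show ?thesis
  proof (rule lift_relI)
    fix W G h k l
    assume [simp]: "h \<in> Arr C" "Dom C h = W" "Cod C h = Z" "G \<in> Obj C" "k \<in> Arr C" "l \<in> Arr C"
      "Dom C k = Prod C W X'" "Dom C l = Prod C W Y'" "Cod C k = FObj T G" "Cod C l = FObj U G"
    assume eq: "\<And>V j x y. \<lbrakk>j \<in> Arr C; Dom C j = V; Cod C j = W; Q V x y\<rbrakk>
        \<Longrightarrow> \<alpha> G \<cdot> k \<cdot> tuple C j x = l \<cdot> tuple C j y"
    have [simp]: "W \<in> Obj C" "Z \<in> Obj C"
      using T.dom_obj[of h] T.cod_obj[of h] by simp_all
    \<comment> \<open>\<open>K\<close> and \<open>L\<close> run m and n, moved to the stage W along
      h, and pass the results to k and l; \<open>bind_bind\<close> reduces the goal to a test of u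
      and v with them.\<close>
    define K where "K = bind C T X' G
        (k \<cdot> tuple C (Pr1 C W X \<cdot> Pr1 C (Prod C W X) X') (Pr2 C (Prod C W X) X'))
        (m \<cdot> tuple C (h \<cdot> Pr1 C W X) (Pr2 C W X))"
    define L where "L = bind C U Y' G
        (l \<cdot> tuple C (Pr1 C W Y \<cdot> Pr1 C (Prod C W Y) Y') (Pr2 C (Prod C W Y) Y'))
        (n \<cdot> tuple C (h \<cdot> Pr1 C W Y) (Pr2 C W Y))"
    have [simp]: "K \<in> Arr C" "Dom C K = Prod C W X" "Cod C K = FObj T G"
      "L \<in> Arr C" "Dom C L = Prod C W Y" "Cod C L = FObj U G"
      by (simp_all add: K_def L_def)
    have "\<alpha> G \<cdot> bind C T X G K (u \<cdot> h) = bind C U Y G L (v \<cdot> h)"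
    proof (rule lift_relD(7)[OF r])
      fix V j x y
      assume [simp]: "j \<in> Arr C" "Dom C j = V" "Cod C j = W" and xy: "P V x y"
      note [simp] = kripkeD(3)[OF P xy]
      have [simp]: "V \<in> Obj C"
        using T.dom_obj[of j] by simp
      have KL: "K \<cdot> tuple C j x = bind C T X' G (k \<cdot> tuple C (j \<cdot> Pr1 C V X') (Pr2 C V X'))
          (m \<cdot> tuple C (h \<cdot> j) x)"
        "L \<cdot> tuple C j y = bind C U Y' G (l \<cdot> tuple C (j \<cdot> Pr1 C V Y') (Pr2 C V Y'))
          (n \<cdot> tuple C (h \<cdot> j) y)"
        by (simp_all add: K_def L_def T.bind_comp U.bind_comp)
      \<comment> \<open>At fixed x and y the outputs of m and n are lifted at stage V; they are
        tested there, along the identity, with k and l restricted along j.\<close>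
      have "lift_rel X' Y' Q V (m \<cdot> tuple C (h \<cdot> j) x) (n \<cdot> tuple C (h \<cdot> j) y)"
        by (rule mn) (simp_all add: xy)
      then have "\<alpha> G \<cdot> bind C T X' G (k \<cdot> tuple C (j \<cdot> Pr1 C V X') (Pr2 C V X'))
            ((m \<cdot> tuple C (h \<cdot> j) x) \<cdot> Id C V)
        = bind C U Y' G (l \<cdot> tuple C (j \<cdot> Pr1 C V Y') (Pr2 C V Y'))
            ((n \<cdot> tuple C (h \<cdot> j) y) \<cdot> Id C V)"
      proof (rule lift_relD(7))
        fix V' i a b
        assume [simp]: "i \<in> Arr C" "Dom C i = V'" "Cod C i = V" and ab: "Q V' a b"
        note [simp] = kripkeD(3)[OF Q ab]
        show "\<alpha> G \<cdot> (k \<cdot> tuple C (j \<cdot> Pr1 C V X') (Pr2 C V X')) \<cdot> tuple C i a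
          = (l \<cdot> tuple C (j \<cdot> Pr1 C V Y') (Pr2 C V Y')) \<cdot> tuple C i b"
          using eq[of "j \<cdot> i" V' a b] ab by simp
      qed simp_all
      then show "\<alpha> G \<cdot> K \<cdot> tuple C j x = L \<cdot> tuple C j y"
        by (simp add: KL)
    qed simp_all
    then show "\<alpha> G \<cdot> bind C T X' G k (bind C T X X' m u \<cdot> h)
      = bind C U Y' G l (bind C U Y Y' n v \<cdot> h)"
      by (simp add: T.bind_comp U.bind_comp T.bind_bind U.bind_bind K_def L_def)
  qed simp_all
qed

text \<open>The functor image is a bind with a unit as continuation, so no separate argument about
  tests is needed.\<close>

lemma lift_rel_fmap:
  assumes r: "lift_rel X Y P Z u v" and P: "kripke C X Y P" and Q: "kripke C X' Y' Q"
    and f: "f \<in> Arr C" "Dom C f = X" "Cod C f = X'" and g: "g \<in> Arr C" "Dom C g = Y" "Cod C g = Y'"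
    and fg: "\<And>V x y. P V x y \<Longrightarrow> Q V (f \<cdot> x) (g \<cdot> y)"
  shows "lift_rel X' Y' Q Z (FMap T f \<cdot> u) (FMap U g \<cdot> v)"
proof -
  note [simp] = kripkeD(1,2)[OF P] kripkeD(1,2)[OF Q] lift_relD(1-6)[OF r] f g
  have [simp]: "Z \<in> Obj C"
    using T.dom_obj[of u] by simp
  have "lift_rel X' Y' Q Z (bind C T X X' (Unit T X' \<cdot> f \<cdot> Pr2 C Z X) u)
      (bind C U Y Y' (Unit U Y' \<cdot> g \<cdot> Pr2 C Z Y) v)"
  proof (rule lift_rel_bind[OF r P Q])
    fix V j x y
    assume [simp]: "j \<in> Arr C" "Dom C j = V" "Cod C j = Z" and xy: "P V x y"
    note [simp] = kripkeD(3)[OF P xy]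
    show "lift_rel X' Y' Q V ((Unit T X' \<cdot> f \<cdot> Pr2 C Z X) \<cdot> tuple C j x)
        ((Unit U Y' \<cdot> g \<cdot> Pr2 C Z Y) \<cdot> tuple C j y)"
      using lift_rel_unit[OF Q fg[OF xy]] by simp
  qed simp_all
  then show ?thesis
    using T.bind_fmap[of f u X X'] U.bind_fmap[of g v Y Y'] by simp
qed

lemma lift_rel_mult_fmap:
  assumes r: "lift_rel X Y P Z u v" and P: "kripke C X Y P" and Q: "kripke C X' Y' Q"
    and f: "f \<in> Arr C" "Dom C f = X" "Cod C f = FObj T X'"
    and g: "g \<in> Arr C" "Dom C g = Y" "Cod C g = FObj U Y'"
    and fg: "\<And>V x y. P V x y \<Longrightarrow> lift_rel X' Y' Q V (f \<cdot> x) (g \<cdot> y)"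
  shows "lift_rel X' Y' Q Z (Mult T X' \<cdot> FMap T f \<cdot> u) (Mult U Y' \<cdot> FMap U g \<cdot> v)"
proof -
  note [simp] = kripkeD(1,2)[OF P] kripkeD(1,2)[OF Q] lift_relD(1-6)[OF r] f g
  have [simp]: "Z \<in> Obj C"
    using T.dom_obj[of u] by simp
  have "lift_rel X' Y' Q Z (bind C T X X' (f \<cdot> Pr2 C Z X) u) (bind C U Y Y' (g \<cdot> Pr2 C Z Y) v)"
  proof (rule lift_rel_bind[OF r P Q])
    fix V j x y
    assume [simp]: "j \<in> Arr C" "Dom C j = V" "Cod C j = Z" and xy: "P V x y"
    note [simp] = kripkeD(3)[OF P xy]
    show "lift_rel X' Y' Q V ((f \<cdot> Pr2 C Z X) \<cdot> tuple C j x) ((g \<cdot> Pr2 C Z Y) \<cdot> tuple C j y)"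
      using fg[OF xy] by simp
  qed simp_all
  then show ?thesis
    using T.bind_mult_fmap[of f u X X'] U.bind_mult_fmap[of g v Y Y'] by simp
qed

text \<open>Two applications of \<open>lift_rel_bind\<close>, following the nested binds. When the
  second value arrives at a later stage, the first is restricted along i, so Kripke closure of P
  enters.\<close>

lemma lift_rel_pair:
  assumes r: "lift_rel X Y P Z u v" and r': "lift_rel X' Y' P' Z u' v'"
    and P: "kripke C X Y P" and P': "kripke C X' Y' P'"
  shows "lift_rel (Prod C X X') (Prod C Y Y') (prod_rel C X Y X' Y' P P') Z
    (Mult T (Prod C X X') \<cdot> st_both C T X X' \<cdot> tuple C u u')
    (Mult U (Prod C Y Y') \<cdot> st_both C U Y Y' \<cdot> tuple C v v')"
proof -
  note [simp] = kripkeD(1,2)[OF P] kripkeD(1,2)[OF P'] lift_relD(1-6)[OF r] lift_relD(1-6)[OF r']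
  note PP' = T.kripke_prod_rel[OF P P']
  have [simp]: "Z \<in> Obj C"
    using T.dom_obj[of u] by simp
  let ?m = "bind C T X' (Prod C X X') (Unit T (Prod C X X') \<cdot> tuple C (Pr2 C Z X \<cdot>
      Pr1 C (Prod C Z X) X') (Pr2 C (Prod C Z X) X')) (u' \<cdot> Pr1 C Z X)"
  let ?n = "bind C U Y' (Prod C Y Y') (Unit U (Prod C Y Y') \<cdot> tuple C (Pr2 C Z Y \<cdot>
      Pr1 C (Prod C Z Y) Y') (Pr2 C (Prod C Z Y) Y')) (v' \<cdot> Pr1 C Z Y)"
  have "lift_rel (Prod C X X') (Prod C Y Y') (prod_rel C X Y X' Y' P P') Z
      (bind C T X (Prod C X X') ?m u) (bind C U Y (Prod C Y Y') ?n v)"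
  proof (rule lift_rel_bind[OF r P PP'])
    fix V j x y
    assume [simp]: "j \<in> Arr C" "Dom C j = V" "Cod C j = Z" and xy: "P V x y"
    note [simp] = kripkeD(3)[OF P xy]
    have [simp]: "V \<in> Obj C"
      using T.dom_obj[of j] by simp
    have "lift_rel (Prod C X X') (Prod C Y Y') (prod_rel C X Y X' Y' P P') V
        (bind C T X' (Prod C X X')
          (Unit T (Prod C X X') \<cdot> tuple C (x \<cdot> Pr1 C V X') (Pr2 C V X')) (u' \<cdot> j))
        (bind C U Y' (Prod C Y Y')
          (Unit U (Prod C Y Y') \<cdot> tuple C (y \<cdot> Pr1 C V Y') (Pr2 C V Y')) (v' \<cdot> j))"
    proof (rule lift_rel_bind[OF lift_rel_comp[OF r'] P' PP'])
      fix V' i x' y'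
      assume [simp]: "i \<in> Arr C" "Dom C i = V'" "Cod C i = V" and xy': "P' V' x' y'"
      note [simp] = kripkeD(3)[OF P' xy']
      have "P V' (x \<cdot> i) (y \<cdot> i)"
        using kripkeD(4)[OF P xy, of i] by simp
      from lift_rel_unit[OF PP' T.prod_rel_tuple[OF P P' this xy']]
      show "lift_rel (Prod C X X') (Prod C Y Y') (prod_rel C X Y X' Y' P P') V'
        ((Unit T (Prod C X X') \<cdot> tuple C (x \<cdot> Pr1 C V X') (Pr2 C V X')) \<cdot> tuple C i x')
        ((Unit U (Prod C Y Y') \<cdot> tuple C (y \<cdot> Pr1 C V Y') (Pr2 C V Y')) \<cdot> tuple C i y')"
        by simp
    qed simp_all
    then show "lift_rel (Prod C X X') (Prod C Y Y') (prod_rel C X Y X' Y' P P') V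
        (?m \<cdot> tuple C j x) (?n \<cdot> tuple C j y)"
      by (simp add: T.bind_comp U.bind_comp)
  qed simp_all
  then show ?thesis
    by (simp add: T.mult_st_both[of u u' Z X X'] U.mult_st_both[of v v' Z Y Y'])
qed

text \<open>From left to right the unit is the test: related values are equal and \<alpha> preserves
  units. From right to left, density turns agreement of k and l on self-related elements into the
  equation between \<alpha> after k and l, and \<open>component_bind\<close> applies.\<close>

lemma lift_rel_sub_diagonal_iff:
  assumes P: "sub_diagonal C X P"
  shows "lift_rel X X P Z u v \<longleftrightarrow>
    u \<in> Arr C \<and> Dom C u = Z \<and> Cod C u = FObj T X \<and> v = \<alpha> X \<cdot> u"
proof -
  note kP = sub_diagonalD(1)[OF P]
  note [simp] = kripkeD(1)[OF kP]
  show ?thesis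
  proof
    assume r: "lift_rel X X P Z u v"
    note [simp] = lift_relD(1-6)[OF r]
    have [simp]: "Z \<in> Obj C"
      using T.dom_obj[of u] by simp
    \<comment> \<open>Here G is X; the identity factor puts the continuation in the form required by
      \<open>bind_fmap\<close>.\<close>
    have "\<alpha> X \<cdot> bind C T X X (Unit T X \<cdot> Id C X \<cdot> Pr2 C Z X) (u \<cdot> Id C Z)
      = bind C U X X (Unit U X \<cdot> Id C X \<cdot> Pr2 C Z X) (v \<cdot> Id C Z)"
    proof (rule lift_relD(7)[OF r])
      fix V j x y
      assume [simp]: "j \<in> Arr C" "Dom C j = V" "Cod C j = Z" and xy: "P V x y"
      note [simp] = kripkeD(3)[OF kP xy]
      show "\<alpha> X \<cdot> (Unit T X \<cdot> Id C X \<cdot> Pr2 C Z X) \<cdot> tuple C j x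
        = (Unit U X \<cdot> Id C X \<cdot> Pr2 C Z X) \<cdot> tuple C j y"
        using sub_diagonalD(2)[OF P xy] by (simp add: component_unit_comp)
    qed simp_all
    then show "u \<in> Arr C \<and> Dom C u = Z \<and> Cod C u = FObj T X \<and> v = \<alpha> X \<cdot> u"
      using T.bind_fmap[of "Id C X" u X X] U.bind_fmap[of "Id C X" v X X] by simp
  next
    assume u: "u \<in> Arr C \<and> Dom C u = Z \<and> Cod C u = FObj T X \<and> v = \<alpha> X \<cdot> u"
    then have [simp]: "u \<in> Arr C" "Dom C u = Z" "Cod C u = FObj T X" "v = \<alpha> X \<cdot> u"
      by simp_all
    show "lift_rel X X P Z u v"
    proof (rule lift_relI)
      fix W G h k l
      assume [simp]: "h \<in> Arr C" "Dom C h = W" "Cod C h = Z" "G \<in> Obj C" "k \<in> Arr C" "l \<in> Arr C"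
        "Dom C k = Prod C W X" "Dom C l = Prod C W X" "Cod C k = FObj T G" "Cod C l = FObj U G"
      assume eq: "\<And>V j x y. \<lbrakk>j \<in> Arr C; Dom C j = V; Cod C j = W; P V x y\<rbrakk>
          \<Longrightarrow> \<alpha> G \<cdot> k \<cdot> tuple C j x = l \<cdot> tuple C j y"
      have [simp]: "W \<in> Obj C"
        using T.dom_obj[of h] by simp
      have "\<alpha> G \<cdot> k = l"
      proof (rule denseD[OF sub_diagonalD(3)[OF P], where W = W])
        fix V j x
        assume [simp]: "j \<in> Arr C" "Dom C j = V" "Cod C j = W" and x: "P V x x"
        note [simp] = kripkeD(3)[OF kP x]
        show "(\<alpha> G \<cdot> k) \<cdot> tuple C j x = l \<cdot> tuple C j x"
          using eq[of j V] x by simp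
      qed simp_all
      then show "\<alpha> G \<cdot> bind C T X G k (u \<cdot> h) = bind C U X G l (v \<cdot> h)"
        by (simp add: component_bind)
    qed simp_all
  qed
qed

section \<open>The relation at function types\<close>

definition fun_rel :: "'o \<Rightarrow> 'o \<Rightarrow> 'o \<Rightarrow> 'o \<Rightarrow> ('o, 'm) krel \<Rightarrow> ('o, 'm) krel \<Rightarrow> ('o, 'm) krel" where
  "fun_rel X Y X' Y' P Q Z f g \<longleftrightarrow>
     f \<in> hom C Z (Exp C (FObj T X') X) \<and> g \<in> hom C Z (Exp C (FObj U Y') Y) \<and>
     (\<forall>W h x y. h \<in> hom C W Z \<longrightarrow> P W x y \<longrightarrow>
        lift_rel X' Y' Q W (Ev C (FObj T X') X \<cdot> tuple C (f \<cdot> h) x)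
          (Ev C (FObj U Y') Y \<cdot> tuple C (g \<cdot> h) y))"

text \<open>Arguments range over all later stages, so restricting the functions only composes the
  change of stage.\<close>

lemma kripke_fun_rel:
  assumes "X \<in> Obj C" "Y \<in> Obj C" "X' \<in> Obj C" "Y' \<in> Obj C"
  shows "kripke C (Exp C (FObj T X') X) (Exp C (FObj U Y') Y) (fun_rel X Y X' Y' P Q)"
  unfolding kripke_def
proof (intro conjI allI impI)
  fix Z W f g h
  assume r: "fun_rel X Y X' Y' P Q Z f g" and h: "h \<in> hom C W Z"
  show "fun_rel X Y X' Y' P Q W (f \<cdot> h) (g \<cdot> h)"
    unfolding fun_rel_def
  proof (intro conjI allI impI)
    fix V i x y
    assume i: "i \<in> hom C V W" and xy: "P V x y"
    have "h \<cdot> i \<in> hom C V Z"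
      using h i by (simp add: hom_def)
    then have "lift_rel X' Y' Q V (Ev C (FObj T X') X \<cdot> tuple C (f \<cdot> h \<cdot> i) x)
        (Ev C (FObj U Y') Y \<cdot> tuple C (g \<cdot> h \<cdot> i) y)"
      using r xy unfolding fun_rel_def by blast
    then show "lift_rel X' Y' Q V (Ev C (FObj T X') X \<cdot> tuple C ((f \<cdot> h) \<cdot> i) x)
        (Ev C (FObj U Y') Y \<cdot> tuple C ((g \<cdot> h) \<cdot> i) y)"
      using r h i by (simp add: fun_rel_def hom_def)
  qed (use r h in \<open>simp_all add: fun_rel_def hom_def\<close>)
qed (use assms in \<open>simp_all add: fun_rel_def\<close>)

end


section \<open>The interpretation of derivations\<close>

lemma derives_types:
  assumes "lc_signature \<Sigma>" "derives \<Sigma> \<Gamma> D M t" "\<forall>(x, s) \<in> set \<Gamma>. s \<in> types \<Sigma>"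
  shows "t \<in> types \<Sigma>"
  using assms(2,3)
proof (induction rule: derives.induct)
  case (1 \<Gamma> x t)
  then show ?case
    using map_of_SomeD by fastforce
qed (use assms(1) in \<open>auto simp: types_def lc_signature_def ground_types_def\<close>)

text \<open>Instantiated at both A and its transport below, so that the typing of the semantics is
  proved once.\<close>

locale lc_model = strong_monad "cat A" "monad A"
  for A :: "('o, 'm, 'b, 'k, 'e) lc_structure" +
  fixes \<Sigma> :: "('b, 'k, 'e) signature"
  assumes signature: "lc_signature \<Sigma>"
    and struct: "lc_structure \<Sigma> A"
begin

abbreviation "\<C> \<equiv> cat A"

lemma ty_obj_obj [simp]: "t \<in> types \<Sigma> \<Longrightarrow> ty_obj A t \<in> Obj \<C>"
  using struct by (induction t) (auto simp: types_def lc_structure_def)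

lemma ctx_obj_obj [simp]: "\<forall>(x, s) \<in> set \<Gamma>. s \<in> types \<Sigma> \<Longrightarrow> ctx_obj A \<Gamma> \<in> Obj \<C>"
  by (induction \<Gamma>) auto

lemma car_types [simp]:
  "c \<in> consts_of \<Sigma> \<Longrightarrow> car \<Sigma> (Inl c) \<in> types \<Sigma>" "c \<in> consts_of \<Sigma> \<Longrightarrow> ar \<Sigma> (Inl c) \<in> types \<Sigma>"
  "e \<in> effects_of \<Sigma> \<Longrightarrow> car \<Sigma> (Inr e) \<in> types \<Sigma>" "e \<in> effects_of \<Sigma> \<Longrightarrow> ar \<Sigma> (Inr e) \<in> types \<Sigma>"
  using signature by (auto simp: lc_signature_def ground_types_def)

lemma interp_arr [simp]:
  "c \<in> consts_of \<Sigma> \<Longrightarrow> interp A (Inl c) \<in> Arr \<C>"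
  "c \<in> consts_of \<Sigma> \<Longrightarrow> Dom \<C> (interp A (Inl c)) = ty_obj A (ar \<Sigma> (Inl c))"
  "c \<in> consts_of \<Sigma> \<Longrightarrow> Cod \<C> (interp A (Inl c)) = ty_obj A (car \<Sigma> (Inl c))"
  "e \<in> effects_of \<Sigma> \<Longrightarrow> interp A (Inr e) \<in> Arr \<C>"
  "e \<in> effects_of \<Sigma> \<Longrightarrow> Dom \<C> (interp A (Inr e)) = ty_obj A (ar \<Sigma> (Inr e))"
  "e \<in> effects_of \<Sigma> \<Longrightarrow> Cod \<C> (interp A (Inr e)) = FObj (monad A) (ty_obj A (car \<Sigma> (Inr e)))"
  using struct by (auto simp: lc_structure_def hom_def)

lemma ctx_proj_arr:
  assumes "map_of \<Gamma> x = Some t" "\<forall>(x, s) \<in> set \<Gamma>. s \<in> types \<Sigma>"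
  shows "ctx_proj A \<Gamma> x \<in> Arr \<C> \<and> Dom \<C> (ctx_proj A \<Gamma> x) = ctx_obj A \<Gamma> \<and>
    Cod \<C> (ctx_proj A \<Gamma> x) = ty_obj A t"
  using assms by (induction \<Gamma>) (auto split: if_splits)

lemma sem_arr:
  assumes "derives \<Sigma> \<Gamma> D M t" "\<forall>(x, s) \<in> set \<Gamma>. s \<in> types \<Sigma>"
  shows "sem \<Sigma> A \<Gamma> D \<in> Arr \<C> \<and> Dom \<C> (sem \<Sigma> A \<Gamma> D) = ctx_obj A \<Gamma> \<and>
    Cod \<C> (sem \<Sigma> A \<Gamma> D) = FObj (monad A) (ty_obj A t)"
  using assms
proof (induction rule: derives.induct)
  case (1 \<Gamma> x t)
  then have "t \<in> types \<Sigma>"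
    by (intro derives_types[OF signature derives.intros(1)])
  with 1 show ?case
    using ctx_proj_arr[OF 1(1)] by simp
next
  case (5 \<Gamma> D M t1 E N t2)
  then have "t1 \<in> types \<Sigma>" "t2 \<in> types \<Sigma>"
    using derives_types[OF signature] by blast+
  with 5 show ?case
    by simp
next
  case (6 \<Gamma> D M t1 t2)
  then have "TProd t1 t2 \<in> types \<Sigma>"
    using derives_types[OF signature] by blast
  then have "t1 \<in> types \<Sigma>" "t2 \<in> types \<Sigma>"
    by (auto simp: types_def)
  with 6 show ?case
    by simp
next
  case (7 \<Gamma> D M t1 t2)
  then have "TProd t1 t2 \<in> types \<Sigma>"
    using derives_types[OF signature] by blast
  then have "t1 \<in> types \<Sigma>" "t2 \<in> types \<Sigma>"
    by (auto simp: types_def)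
  with 7 show ?case
    by simp
next
  case (9 t2 \<Gamma> D M t1)
  then have "t1 \<in> types \<Sigma>"
    using derives_types[OF signature] by blast
  with 9 show ?case
    by simp
next
  case (10 t1 \<Gamma> D M t2)
  then have "t2 \<in> types \<Sigma>"
    using derives_types[OF signature] by blast
  with 10 show ?case
    by simp
next
  case (11 \<Gamma> D M t1 t2 x1 E1 N1 t x2 E2 N2)
  then have "TSum t1 t2 \<in> types \<Sigma>"
    using derives_types[OF signature] by blast
  then have t12: "t1 \<in> types \<Sigma>" "t2 \<in> types \<Sigma>"
    by (auto simp: types_def)
  then have "t \<in> types \<Sigma>"
    using derives_types[OF signature 11(2)] 11 by simp
  with 11 t12 show ?case
    by simp
next
  case (12 t1 x \<Gamma> D M t2)
  then have "t2 \<in> types \<Sigma>"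
    using derives_types[OF signature 12(2)] by simp
  with 12 show ?case
    by simp
next
  case (13 \<Gamma> D M t1 t2 E N)
  then have "TFun t1 t2 \<in> types \<Sigma>"
    using derives_types[OF signature] by blast
  then have "t1 \<in> types \<Sigma>" "t2 \<in> types \<Sigma>"
    by (auto simp: types_def)
  with 13 show ?case
    by simp
qed auto

end


section \<open>The logical relation\<close>

locale lc_transport = strong_monad_morphism "cat A" "monad A" U \<alpha>
  for A :: "('o, 'm, 'b, 'k, 'e) lc_structure" and U :: "('o, 'm) strong_monad"
    and \<alpha> :: "'o \<Rightarrow> 'm" +
  fixes \<Sigma> :: "('b, 'k, 'e) signature"
  assumes signature: "lc_signature \<Sigma>"
    and struct: "lc_structure \<Sigma> A"
begin

abbreviation "B \<equiv> transport \<Sigma> U \<alpha> A"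

lemma transport_sel [simp]:
  "cat B = cat A" "monad B = U" "base_obj B = base_obj A"
  "interp B (Inl c) = interp A (Inl c)"
  "interp B (Inr e) = \<alpha> (ty_obj A (car \<Sigma> (Inr e))) \<cdot>\<^bsub>cat A\<^esub> interp A (Inr e)"
  by (simp_all add: transport_def)

lemma ty_obj_transport: "ground t \<Longrightarrow> ty_obj B t = ty_obj A t"
  by (induction t) simp_all

lemma ctx_obj_transport: "\<forall>(x, s) \<in> set \<Gamma>. ground s \<Longrightarrow> ctx_obj B \<Gamma> = ctx_obj A \<Gamma>"
  by (induction \<Gamma>) (auto simp: ty_obj_transport)

lemma ground_signature:
  "c \<in> consts_of \<Sigma> \<Longrightarrow> ground (car \<Sigma> (Inl c))" "c \<in> consts_of \<Sigma> \<Longrightarrow> ground (ar \<Sigma> (Inl c))"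
  "e \<in> effects_of \<Sigma> \<Longrightarrow> ground (car \<Sigma> (Inr e))" "e \<in> effects_of \<Sigma> \<Longrightarrow> ground (ar \<Sigma> (Inr e))"
  using signature by (auto simp: lc_signature_def ground_types_def)

sublocale A: lc_model A \<Sigma>
  by unfold_locales (fact signature struct)+

lemma lc_structure_transport: "lc_structure \<Sigma> B"
  using struct U.strong_monad_axioms
  by (auto simp: lc_structure_def ty_obj_transport ground_signature hom_def)

sublocale B: lc_model B \<Sigma>
  using U.strong_monad_axioms signature lc_structure_transport
  by (simp add: lc_model_def lc_model_axioms_def)

text \<open>Heterogeneous, since the two carriers may differ as soon as \<open>TFun\<close> occurs;
  values only, computations being compared by \<open>comp_rel\<close>.\<close>

primrec rel :: "'b ty \<Rightarrow> ('o, 'm) krel" where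
  "rel (Base b) = eq_rel (cat A) (base_obj A b)"
| "rel TOne = eq_rel (cat A) (One (cat A))"
| "rel (TProd s t) =
     prod_rel (cat A) (ty_obj A s) (ty_obj B s) (ty_obj A t) (ty_obj B t) (rel s) (rel t)"
| "rel TZero = empty_rel"
| "rel (TSum s t) =
     sum_rel (cat A) (ty_obj A s) (ty_obj B s) (ty_obj A t) (ty_obj B t) (rel s) (rel t)"
| "rel (TFun s t) =
     fun_rel (ty_obj A s) (ty_obj B s) (ty_obj A t) (ty_obj B t) (rel s) (rel t)"

primrec ctx_rel :: "('v, 'b) ctx \<Rightarrow> ('o, 'm) krel" where
  "ctx_rel [] = eq_rel (cat A) (One (cat A))"
| "ctx_rel (xt # \<Gamma>) = prod_rel (cat A) (ctx_obj A \<Gamma>) (ctx_obj B \<Gamma>)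
     (ty_obj A (snd xt)) (ty_obj B (snd xt)) (ctx_rel \<Gamma>) (rel (snd xt))"

abbreviation comp_rel :: "'b ty \<Rightarrow> ('o, 'm) krel" where
  "comp_rel t \<equiv> lift_rel (ty_obj A t) (ty_obj B t) (rel t)"

lemma ty_obj_transport_obj [simp]: "t \<in> types \<Sigma> \<Longrightarrow> ty_obj B t \<in> Obj (cat A)"
  using B.ty_obj_obj by simp

lemma ctx_obj_transport_obj [simp]:
  "\<forall>(x, s) \<in> set \<Gamma>. s \<in> types \<Sigma> \<Longrightarrow> ctx_obj B \<Gamma> \<in> Obj (cat A)"
  using B.ctx_obj_obj by simp

lemma base_obj_obj: "b \<in> bases \<Sigma> \<Longrightarrow> base_obj A b \<in> Obj (cat A)"
  using struct by (auto simp: lc_structure_def)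

lemma kripke_rel: "t \<in> types \<Sigma> \<Longrightarrow> kripke (cat A) (ty_obj A t) (ty_obj B t) (rel t)"
proof (induction t)
  case (TFun s t)
  then have "s \<in> types \<Sigma>" "t \<in> types \<Sigma>"
    by (auto simp: types_def)
  then show ?case
    by (simp add: kripke_fun_rel)
qed (auto simp: types_def intro: T.kripke_eq_rel T.kripke_prod_rel T.kripke_sum_rel
      T.kripke_empty_rel base_obj_obj)

lemma kripke_ctx_rel:
  "\<forall>(x, s) \<in> set \<Gamma>. s \<in> types \<Sigma> \<Longrightarrow> kripke (cat A) (ctx_obj A \<Gamma>) (ctx_obj B \<Gamma>) (ctx_rel \<Gamma>)"
  by (induction \<Gamma>) (auto intro!: T.kripke_eq_rel T.kripke_prod_rel kripke_rel)

lemma sub_diagonal_rel: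
  "t \<in> types \<Sigma> \<Longrightarrow> ground t \<Longrightarrow> sub_diagonal (cat A) (ty_obj A t) (rel t)"
  by (induction t) (auto simp: types_def ty_obj_transport intro: T.sub_diagonal_eq_rel
      T.sub_diagonal_prod_rel T.sub_diagonal_sum_rel T.sub_diagonal_empty_rel base_obj_obj)

lemma sub_diagonal_ctx_rel:
  "\<forall>(x, s) \<in> set \<Gamma>. s \<in> types \<Sigma> \<and> ground s \<Longrightarrow> sub_diagonal (cat A) (ctx_obj A \<Gamma>) (ctx_rel \<Gamma>)"
proof (induction \<Gamma>)
  case (Cons xt \<Gamma>)
  moreover from this have "ctx_obj B \<Gamma> = ctx_obj A \<Gamma>"
    by (intro ctx_obj_transport) auto
  ultimately show ?case
    by (auto simp: ty_obj_transport intro!: T.sub_diagonal_prod_rel sub_diagonal_rel)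
qed (simp add: T.sub_diagonal_eq_rel)

lemma lift_rel_ground:
  "\<lbrakk>t \<in> types \<Sigma>; ground t\<rbrakk> \<Longrightarrow> lift_rel (ty_obj A t) (ty_obj A t) (rel t) Z u v \<longleftrightarrow>
     u \<in> Arr (cat A) \<and> Dom (cat A) u = Z \<and>
     Cod (cat A) u = FObj (monad A) (ty_obj A t) \<and> v = \<alpha> (ty_obj A t) \<cdot>\<^bsub>cat A\<^esub> u"
  using lift_rel_sub_diagonal_iff[OF sub_diagonal_rel] by simp

lemma ctx_proj_rel:
  assumes "map_of \<Gamma> x = Some t" "\<forall>(x, s) \<in> set \<Gamma>. s \<in> types \<Sigma>" "ctx_rel \<Gamma> Z \<gamma> \<gamma>'"
  shows "rel t Z (ctx_proj A \<Gamma> x \<cdot>\<^bsub>cat A\<^esub> \<gamma>) (ctx_proj B \<Gamma> x \<cdot>\<^bsub>cat A\<^esub> \<gamma>')"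
  using assms
proof (induction \<Gamma> arbitrary: \<gamma> \<gamma>')
  case (Cons ys \<Gamma>)
  obtain y s where [simp]: "ys = (y, s)"
    by fastforce
  have \<Gamma>: "\<forall>(x, s) \<in> set \<Gamma>. s \<in> types \<Sigma>" and [simp]: "s \<in> types \<Sigma>"
    using Cons.prems(2) by auto
  show ?case
  proof (cases "y = x")
    case True
    then show ?thesis
      using Cons.prems by (simp add: prod_rel_def)
  next
    case False
    then have "map_of \<Gamma> x = Some t"
      using Cons.prems(1) by simp
    with False show ?thesis
      using Cons.IH[OF _ \<Gamma>] Cons.prems(3) \<Gamma> A.ctx_proj_arr[of \<Gamma> x t] B.ctx_proj_arr[of \<Gamma> x t]
      by (auto simp: prod_rel_def hom_def)
  qed
qed simp

text \<open>Fundamental lemma. Stage and environments are kept arbitrary because the branches of a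
  case and the body of an abstraction are used at later stages, in environments extended by a
  related value.\<close>

lemma sem_rel:
  assumes "derives \<Sigma> \<Gamma> D M t" "\<forall>(x, s) \<in> set \<Gamma>. s \<in> types \<Sigma>" "ctx_rel \<Gamma> Z \<gamma> \<gamma>'"
  shows "comp_rel t Z (sem \<Sigma> A \<Gamma> D \<cdot>\<^bsub>cat A\<^esub> \<gamma>) (sem \<Sigma> B \<Gamma> D \<cdot>\<^bsub>cat A\<^esub> \<gamma>')"
proof -
  note types = derives_types[OF signature]
  have sem: "sem \<Sigma> A \<Gamma> D \<in> Arr (cat A)" "Dom (cat A) (sem \<Sigma> A \<Gamma> D) = ctx_obj A \<Gamma>"
    "Cod (cat A) (sem \<Sigma> A \<Gamma> D) = FObj (monad A) (ty_obj A t)"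
    "sem \<Sigma> B \<Gamma> D \<in> Arr (cat A)" "Dom (cat A) (sem \<Sigma> B \<Gamma> D) = ctx_obj B \<Gamma>"
    "Cod (cat A) (sem \<Sigma> B \<Gamma> D) = FObj U (ty_obj B t)"
    if "derives \<Sigma> \<Gamma> D M t" "\<forall>(x, s) \<in> set \<Gamma>. s \<in> types \<Sigma>"
    for \<Gamma> :: "('v, 'b) ctx" and D :: "('v, 'b, 'k, 'e) deriv" and M t
    using A.sem_arr[OF that] B.sem_arr[OF that] by simp_all
  note ctx = kripkeD(3)[OF kripke_ctx_rel]
  show ?thesis
    using assms
  proof (induction arbitrary: Z \<gamma> \<gamma>' rule: derives.induct)
    case (1 \<Gamma> x t)
    then have t: "t \<in> types \<Sigma>"
      by (intro types[OF derives.intros(1)])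
    show ?case
      using lift_rel_unit[OF kripke_rel[OF t] ctx_proj_rel[OF 1]] ctx[OF 1(2,3)] t 1
        A.ctx_proj_arr[OF 1(1,2)] B.ctx_proj_arr[OF 1(1,2)]
      by simp
  next
    \<comment> \<open>Arity and coarity are ground, so by \<open>lift_rel_ground\<close> hypothesis
      and goal are equations, linked by naturality of \<alpha>.\<close>
    case (2 c \<Gamma> D M)
    note [simp] = sem[OF 2(2,4)] ctx[OF 2(4,5)] ground_signature(1,2)[OF 2(1)] 2(1)
    show ?case
      using 2 by (simp add: lift_rel_ground component_fmap_comp ty_obj_transport)
  next
    \<comment> \<open>As for constants, with preservation of multiplication in addition; the
      component of \<alpha> in the transported effect is the one that this law produces.\<close>
    case (3 e \<Gamma> D M)
    note [simp] = sem[OF 3(2,4)] ctx[OF 3(4,5)] ground_signature(3,4)[OF 3(1)] 3(1)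
    show ?case
      using 3 by (simp add: lift_rel_ground component_fmap_comp component_mult_comp ty_obj_transport)
  next
    case (4 \<Gamma>)
    note [simp] = ctx[OF 4]
    \<comment> \<open>Both environments live at the same stage Z, so the two composites into the
      terminal object coincide.\<close>
    have "to_one (cat A) (ctx_obj B \<Gamma>) \<cdot>\<^bsub>cat A\<^esub> \<gamma>' = to_one (cat A) (ctx_obj A \<Gamma>) \<cdot>\<^bsub>cat A\<^esub> \<gamma>"
      by (rule T.to_one_eq) (use 4 in simp_all)
    then have "rel TOne Z (to_one (cat A) (ctx_obj A \<Gamma>) \<cdot>\<^bsub>cat A\<^esub> \<gamma>)
        (to_one (cat A) (ctx_obj B \<Gamma>) \<cdot>\<^bsub>cat A\<^esub> \<gamma>')"
      using 4 by (simp add: eq_rel_def hom_def)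
    from lift_rel_unit[OF kripke_rel this] 4 show ?case
      by (simp add: types_def)
  next
    case (5 \<Gamma> D M t1 E N t2)
    have [simp]: "t1 \<in> types \<Sigma>" "t2 \<in> types \<Sigma>"
      using types 5 by blast+
    note [simp] = sem[OF 5(1,5)] sem[OF 5(2,5)] ctx[OF 5(5,6)]
    show ?case
      using lift_rel_pair[OF 5(3)[OF 5(5,6)] 5(4)[OF 5(5,6)] kripke_rel kripke_rel] by simp
  next
    case (6 \<Gamma> D M t1 t2)
    have t: "TProd t1 t2 \<in> types \<Sigma>"
      using types 6 by blast
    then have [simp]: "t1 \<in> types \<Sigma>" "t2 \<in> types \<Sigma>"
      by (auto simp: types_def)
    note [simp] = sem[OF 6(1,3)] ctx[OF 6(3,4)]
    show ?case
      using lift_rel_fmap[OF 6(2)[OF 6(3,4)] kripke_rel[OF t] kripke_rel[of t1],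
          of "Pr1 (cat A) (ty_obj A t1) (ty_obj A t2)" "Pr1 (cat A) (ty_obj B t1) (ty_obj B t2)"]
      by (simp add: prod_rel_def)
  next
    case (7 \<Gamma> D M t1 t2)
    have t: "TProd t1 t2 \<in> types \<Sigma>"
      using types 7 by blast
    then have [simp]: "t1 \<in> types \<Sigma>" "t2 \<in> types \<Sigma>"
      by (auto simp: types_def)
    note [simp] = sem[OF 7(1,3)] ctx[OF 7(3,4)]
    show ?case
      using lift_rel_fmap[OF 7(2)[OF 7(3,4)] kripke_rel[OF t] kripke_rel[of t2],
          of "Pr2 (cat A) (ty_obj A t1) (ty_obj A t2)" "Pr2 (cat A) (ty_obj B t1) (ty_obj B t2)"]
      by (simp add: prod_rel_def)
  next
    case (8 t \<Gamma> D M)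
    have z: "TZero \<in> types \<Sigma>"
      by (simp add: types_def)
    note [simp] = sem[OF 8(2,4)] ctx[OF 8(4,5)] 8(1)
    \<comment> \<open>No values of the empty type are related, so the condition on the two maps
      under the functors is vacuous.\<close>
    show ?case
      using lift_rel_fmap[OF 8(3)[OF 8(4,5)] kripke_rel[OF z] kripke_rel[of t],
          of "from_zero (cat A) (ty_obj A t)" "from_zero (cat A) (ty_obj B t)"]
      by (simp add: empty_rel_def)
  next
    case (9 t2 \<Gamma> D M t1)
    have [simp]: "t1 \<in> types \<Sigma>"
      using types 9 by blast
    have t: "TSum t1 t2 \<in> types \<Sigma>"
      using 9(1) \<open>t1 \<in> types \<Sigma>\<close> by (simp add: types_def)
    note [simp] = sem[OF 9(2,4)] ctx[OF 9(4,5)] 9(1)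
    have "rel (TSum t1 t2) V (In1 (cat A) (ty_obj A t1) (ty_obj A t2) \<cdot>\<^bsub>cat A\<^esub> x)
        (In1 (cat A) (ty_obj B t1) (ty_obj B t2) \<cdot>\<^bsub>cat A\<^esub> y)" if "rel t1 V x y" for V x y
      using that by (auto simp: sum_rel_def)
    with lift_rel_fmap[OF 9(3)[OF 9(4,5)] kripke_rel kripke_rel[OF t],
          of "In1 (cat A) (ty_obj A t1) (ty_obj A t2)" "In1 (cat A) (ty_obj B t1) (ty_obj B t2)"]
    show ?case
      by simp
  next
    case (10 t1 \<Gamma> D M t2)
    have [simp]: "t2 \<in> types \<Sigma>"
      using types 10 by blast
    have t: "TSum t1 t2 \<in> types \<Sigma>"
      using 10(1) \<open>t2 \<in> types \<Sigma>\<close> by (simp add: types_def)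
    note [simp] = sem[OF 10(2,4)] ctx[OF 10(4,5)] 10(1)
    have "rel (TSum t1 t2) V (In2 (cat A) (ty_obj A t1) (ty_obj A t2) \<cdot>\<^bsub>cat A\<^esub> x)
        (In2 (cat A) (ty_obj B t1) (ty_obj B t2) \<cdot>\<^bsub>cat A\<^esub> y)" if "rel t2 V x y" for V x y
      using that by (auto simp: sum_rel_def)
    with lift_rel_fmap[OF 10(3)[OF 10(4,5)] kripke_rel kripke_rel[OF t],
          of "In2 (cat A) (ty_obj A t1) (ty_obj A t2)" "In2 (cat A) (ty_obj B t1) (ty_obj B t2)"]
    show ?case
      by simp
  next
    case (11 \<Gamma> D M t1 t2 x1 E1 N1 t x2 E2 N2)
    have t12: "TSum t1 t2 \<in> types \<Sigma>"
      using types 11 by blast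
    then have [simp]: "t1 \<in> types \<Sigma>" "t2 \<in> types \<Sigma>"
      by (auto simp: types_def)
    have \<Gamma>1: "\<forall>(x, s) \<in> set ((x1, t1) # \<Gamma>). s \<in> types \<Sigma>"
      and \<Gamma>2: "\<forall>(x, s) \<in> set ((x2, t2) # \<Gamma>). s \<in> types \<Sigma>"
      using 11(7) by simp_all
    have [simp]: "t \<in> types \<Sigma>"
      by (rule types[OF 11(2) \<Gamma>1])
    note [simp] = sem[OF 11(1,7)] sem[OF 11(2) \<Gamma>1, simplified] sem[OF 11(3) \<Gamma>2, simplified]
      ctx[OF 11(7,8)] ctx_obj_transport_obj[OF 11(7)] A.ctx_obj_obj[OF 11(7)]
    have [simp]: "Z \<in> Obj (cat A)"
      using T.dom_obj[of \<gamma>] by simp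
    let ?G = "ctx_obj A \<Gamma>" and ?G' = "ctx_obj B \<Gamma>" and ?S = "ty_obj A (TSum t1 t2)"
      and ?S' = "ty_obj B (TSum t1 t2)"
    let ?c = "cotuple (cat A) (sem \<Sigma> A ((x1, t1) # \<Gamma>) E1) (sem \<Sigma> A ((x2, t2) # \<Gamma>) E2) \<cdot>\<^bsub>cat A\<^esub>
        dist (cat A) ?G (ty_obj A t1) (ty_obj A t2)"
    let ?c' = "cotuple (cat A) (sem \<Sigma> B ((x1, t1) # \<Gamma>) E1) (sem \<Sigma> B ((x2, t2) # \<Gamma>) E2) \<cdot>\<^bsub>cat A\<^esub>
        dist (cat A) ?G' (ty_obj B t1) (ty_obj B t2)"
    \<comment> \<open>The branch continuations with the environments substituted for the context; by
      \<open>bind_comp\<close> this is the semantics of the case term after \<gamma>, written as a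
      single bind.\<close>
    let ?m = "?c \<cdot>\<^bsub>cat A\<^esub> tuple (cat A) (\<gamma> \<cdot>\<^bsub>cat A\<^esub> Pr1 (cat A) Z ?S) (Pr2 (cat A) Z ?S)"
    let ?n = "?c' \<cdot>\<^bsub>cat A\<^esub> tuple (cat A) (\<gamma>' \<cdot>\<^bsub>cat A\<^esub> Pr1 (cat A) Z ?S') (Pr2 (cat A) Z ?S')"
    have "comp_rel t Z
        (bind (cat A) (monad A) ?S (ty_obj A t) ?m (sem \<Sigma> A \<Gamma> D \<cdot>\<^bsub>cat A\<^esub> \<gamma>))
        (bind (cat A) U ?S' (ty_obj B t) ?n (sem \<Sigma> B \<Gamma> D \<cdot>\<^bsub>cat A\<^esub> \<gamma>'))"
    proof (rule lift_rel_bind[OF 11(4)[OF 11(7,8)] kripke_rel[OF t12] kripke_rel])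
      fix V j x y
      assume [simp]: "j \<in> Arr (cat A)" "Dom (cat A) j = V" "Cod (cat A) j = Z"
        and xy: "rel (TSum t1 t2) V x y"
      have \<gamma>: "ctx_rel \<Gamma> V (\<gamma> \<cdot>\<^bsub>cat A\<^esub> j) (\<gamma>' \<cdot>\<^bsub>cat A\<^esub> j)"
        using kripkeD(4)[OF kripke_ctx_rel[OF 11(7)] 11(8), of j] by simp
      \<comment> \<open>Related scrutinee values come from the same summand, so \<open>dist\<close>
        computes and selects the same branch on both sides.\<close>
      consider a b where "rel t1 V a b" "x = In1 (cat A) (ty_obj A t1) (ty_obj A t2) \<cdot>\<^bsub>cat A\<^esub> a"
          "y = In1 (cat A) (ty_obj B t1) (ty_obj B t2) \<cdot>\<^bsub>cat A\<^esub> b"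
        | a b where "rel t2 V a b" "x = In2 (cat A) (ty_obj A t1) (ty_obj A t2) \<cdot>\<^bsub>cat A\<^esub> a"
          "y = In2 (cat A) (ty_obj B t1) (ty_obj B t2) \<cdot>\<^bsub>cat A\<^esub> b"
        using xy by (auto simp: sum_rel_def)
      then show "comp_rel t V (?m \<cdot>\<^bsub>cat A\<^esub> tuple (cat A) j x) (?n \<cdot>\<^bsub>cat A\<^esub> tuple (cat A) j y)"
      proof cases
        case 1
        note ab [simp] = kripkeD(3)[OF kripke_rel 1(1), simplified]
        have "ctx_rel ((x1, t1) # \<Gamma>) V (tuple (cat A) (\<gamma> \<cdot>\<^bsub>cat A\<^esub> j) a)
            (tuple (cat A) (\<gamma>' \<cdot>\<^bsub>cat A\<^esub> j) b)"
          using T.prod_rel_tuple[OF kripke_ctx_rel[OF 11(7)] kripke_rel[of t1] \<gamma> 1(1)] by simp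
        from 11(5)[OF \<Gamma>1 this] show ?thesis
          by (simp add: 1(2,3) T.dist_tuple_in)
      next
        case 2
        note ab [simp] = kripkeD(3)[OF kripke_rel 2(1), simplified]
        have "ctx_rel ((x2, t2) # \<Gamma>) V (tuple (cat A) (\<gamma> \<cdot>\<^bsub>cat A\<^esub> j) a)
            (tuple (cat A) (\<gamma>' \<cdot>\<^bsub>cat A\<^esub> j) b)"
          using T.prod_rel_tuple[OF kripke_ctx_rel[OF 11(7)] kripke_rel[of t2] \<gamma> 2(1)] by simp
        from 11(6)[OF \<Gamma>2 this] show ?thesis
          by (simp add: 2(2,3) T.dist_tuple_in)
      qed
    qed simp_all
    moreover have "sem \<Sigma> A \<Gamma> (CaseD t D x1 t1 E1 x2 t2 E2) \<cdot>\<^bsub>cat A\<^esub> \<gamma>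
      = bind (cat A) (monad A) ?S (ty_obj A t) ?m (sem \<Sigma> A \<Gamma> D \<cdot>\<^bsub>cat A\<^esub> \<gamma>)"
      using T.bind_comp[of ?c "sem \<Sigma> A \<Gamma> D" ?S "ty_obj A t" \<gamma>] by (simp add: bind_def)
    moreover have "sem \<Sigma> B \<Gamma> (CaseD t D x1 t1 E1 x2 t2 E2) \<cdot>\<^bsub>cat A\<^esub> \<gamma>'
      = bind (cat A) U ?S' (ty_obj B t) ?n (sem \<Sigma> B \<Gamma> D \<cdot>\<^bsub>cat A\<^esub> \<gamma>')"
      using U.bind_comp[of ?c' "sem \<Sigma> B \<Gamma> D" ?S' "ty_obj B t" \<gamma>'] by (simp add: bind_def)
    ultimately show ?case
      by simp
  next
    case (12 t1 x \<Gamma> D M t2)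
    have \<Gamma>: "\<forall>(x, s) \<in> set ((x, t1) # \<Gamma>). s \<in> types \<Sigma>"
      using 12(1,4) by simp
    have [simp]: "t2 \<in> types \<Sigma>"
      by (rule types[OF 12(2) \<Gamma>])
    have t: "TFun t1 t2 \<in> types \<Sigma>"
      using 12(1) \<open>t2 \<in> types \<Sigma>\<close> by (simp add: types_def)
    note [simp] = 12(1) sem[OF 12(2) \<Gamma>, simplified] ctx[OF 12(4,5)]
      ctx_obj_transport_obj[OF 12(4)] A.ctx_obj_obj[OF 12(4)]
    let ?f = "transpose (cat A) (ctx_obj A \<Gamma>) (ty_obj A t1) (sem \<Sigma> A ((x, t1) # \<Gamma>) D)"
    let ?g = "transpose (cat A) (ctx_obj B \<Gamma>) (ty_obj B t1) (sem \<Sigma> B ((x, t1) # \<Gamma>) D)"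
    \<comment> \<open>At a later stage, evaluation of the transposes gives the bodies at the
      restricted environments extended by the arguments, which is the induction hypothesis.\<close>
    have "rel (TFun t1 t2) Z (?f \<cdot>\<^bsub>cat A\<^esub> \<gamma>) (?g \<cdot>\<^bsub>cat A\<^esub> \<gamma>')"
      unfolding rel.simps fun_rel_def
    proof (intro conjI allI impI)
      fix W h a b
      assume h: "h \<in> hom (cat A) W Z" and ab: "rel t1 W a b"
      then have [simp]: "h \<in> Arr (cat A)" "Dom (cat A) h = W" "Cod (cat A) h = Z"
        by (simp_all add: hom_def)
      note [simp] = kripkeD(3)[OF kripke_rel ab, simplified]
      have "ctx_rel \<Gamma> W (\<gamma> \<cdot>\<^bsub>cat A\<^esub> h) (\<gamma>' \<cdot>\<^bsub>cat A\<^esub> h)"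
        using kripkeD(4)[OF kripke_ctx_rel[OF 12(4)] 12(5), of h] by simp
      from T.prod_rel_tuple[OF kripke_ctx_rel[OF 12(4)] kripke_rel[OF 12(1)] this ab]
      have "ctx_rel ((x, t1) # \<Gamma>) W (tuple (cat A) (\<gamma> \<cdot>\<^bsub>cat A\<^esub> h) a)
          (tuple (cat A) (\<gamma>' \<cdot>\<^bsub>cat A\<^esub> h) b)"
        by simp
      from 12(3)[OF \<Gamma> this]
      show "comp_rel t2 W
          (Ev (cat A) (FObj (monad A) (ty_obj A t2)) (ty_obj A t1) \<cdot>\<^bsub>cat A\<^esub>
            tuple (cat A) ((?f \<cdot>\<^bsub>cat A\<^esub> \<gamma>) \<cdot>\<^bsub>cat A\<^esub> h) a)
          (Ev (cat A) (FObj U (ty_obj B t2)) (ty_obj B t1) \<cdot>\<^bsub>cat A\<^esub>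
            tuple (cat A) ((?g \<cdot>\<^bsub>cat A\<^esub> \<gamma>') \<cdot>\<^bsub>cat A\<^esub> h) b)"
        by (simp add: T.ev_transpose)
    qed (simp_all add: hom_def)
    from lift_rel_unit[OF kripke_rel[OF t] this] show ?case
      by simp
  next
    case (13 \<Gamma> D M t1 t2 E N)
    have t: "TFun t1 t2 \<in> types \<Sigma>"
      using types 13 by blast
    then have [simp]: "t1 \<in> types \<Sigma>" "t2 \<in> types \<Sigma>"
      by (auto simp: types_def)
    note [simp] = sem[OF 13(1,5)] sem[OF 13(2,5)] ctx[OF 13(5,6)]
    \<comment> \<open>Application is a pair followed by the Kleisli extension of evaluation:
      naturality and associativity of \<open>Mult\<close> rearrange the composite in
      \<open>sem\<close> into this form.\<close>
    let ?P = "TProd (TFun t1 t2) t1"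
    have P: "?P \<in> types \<Sigma>"
      using t by (simp add: types_def)
    have "comp_rel ?P Z (sem \<Sigma> A \<Gamma> (PairD (TFun t1 t2) t1 D E) \<cdot>\<^bsub>cat A\<^esub> \<gamma>)
        (sem \<Sigma> B \<Gamma> (PairD (TFun t1 t2) t1 D E) \<cdot>\<^bsub>cat A\<^esub> \<gamma>')"
      using lift_rel_pair[OF 13(3)[OF 13(5,6)] 13(4)[OF 13(5,6)] kripke_rel[OF t] kripke_rel] by simp
    then have "comp_rel t2 Z
        (Mult (monad A) (ty_obj A t2) \<cdot>\<^bsub>cat A\<^esub>
          FMap (monad A) (Ev (cat A) (FObj (monad A) (ty_obj A t2)) (ty_obj A t1)) \<cdot>\<^bsub>cat A\<^esub>
          sem \<Sigma> A \<Gamma> (PairD (TFun t1 t2) t1 D E) \<cdot>\<^bsub>cat A\<^esub> \<gamma>)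
        (Mult U (ty_obj B t2) \<cdot>\<^bsub>cat A\<^esub>
          FMap U (Ev (cat A) (FObj U (ty_obj B t2)) (ty_obj B t1)) \<cdot>\<^bsub>cat A\<^esub>
          sem \<Sigma> B \<Gamma> (PairD (TFun t1 t2) t1 D E) \<cdot>\<^bsub>cat A\<^esub> \<gamma>')"
    proof (rule lift_rel_mult_fmap[OF _ kripke_rel[OF P] kripke_rel])
      fix V x y
      assume xy: "rel ?P V x y"
      note [simp] = kripkeD(3)[OF kripke_rel[OF P] xy, simplified]
      have [simp]: "V \<in> Obj (cat A)"
        using T.dom_obj[of x] by simp
      let ?X = "Exp (cat A) (FObj (monad A) (ty_obj A t2)) (ty_obj A t1)"
        and ?Y = "Exp (cat A) (FObj U (ty_obj B t2)) (ty_obj B t1)"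
      have r: "rel (TFun t1 t2) V (Pr1 (cat A) ?X (ty_obj A t1) \<cdot>\<^bsub>cat A\<^esub> x)
          (Pr1 (cat A) ?Y (ty_obj B t1) \<cdot>\<^bsub>cat A\<^esub> y)"
        and r1: "rel t1 V (Pr2 (cat A) ?X (ty_obj A t1) \<cdot>\<^bsub>cat A\<^esub> x)
          (Pr2 (cat A) ?Y (ty_obj B t1) \<cdot>\<^bsub>cat A\<^esub> y)"
        using xy by (simp_all add: prod_rel_def)
      \<comment> \<open>Function and argument already share the stage V, so the clause for functions
        is used at the identity.\<close>
      have "Id (cat A) V \<in> hom (cat A) V V"
        by (simp add: hom_def)
      with r r1 have "comp_rel t2 V
          (Ev (cat A) (FObj (monad A) (ty_obj A t2)) (ty_obj A t1) \<cdot>\<^bsub>cat A\<^esub>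
            tuple (cat A) ((Pr1 (cat A) ?X (ty_obj A t1) \<cdot>\<^bsub>cat A\<^esub> x) \<cdot>\<^bsub>cat A\<^esub> Id (cat A) V)
              (Pr2 (cat A) ?X (ty_obj A t1) \<cdot>\<^bsub>cat A\<^esub> x))
          (Ev (cat A) (FObj U (ty_obj B t2)) (ty_obj B t1) \<cdot>\<^bsub>cat A\<^esub>
            tuple (cat A) ((Pr1 (cat A) ?Y (ty_obj B t1) \<cdot>\<^bsub>cat A\<^esub> y) \<cdot>\<^bsub>cat A\<^esub> Id (cat A) V)
              (Pr2 (cat A) ?Y (ty_obj B t1) \<cdot>\<^bsub>cat A\<^esub> y))"
        unfolding rel.simps fun_rel_def by blast
      then show "comp_rel t2 V
          (Ev (cat A) (FObj (monad A) (ty_obj A t2)) (ty_obj A t1) \<cdot>\<^bsub>cat A\<^esub> x)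
          (Ev (cat A) (FObj U (ty_obj B t2)) (ty_obj B t1) \<cdot>\<^bsub>cat A\<^esub> y)"
        by simp
    qed simp_all
    then show ?case
      by simp
  qed
qed

text \<open>At a self-related environment x, \<open>sem_rel\<close> yields the equation after
  composition with x. Since the identity environment may fail to be self-related, density of
  \<open>ctx_rel\<close> is what removes x.\<close>

lemma component_sem:
  assumes D: "derives \<Sigma> \<Gamma> D M t" and \<Gamma>: "\<forall>(x, s) \<in> set \<Gamma>. s \<in> ground_types \<Sigma>"
    and t: "t \<in> ground_types \<Sigma>"
  shows "\<alpha> (ty_obj A t) \<cdot>\<^bsub>cat A\<^esub> sem \<Sigma> A \<Gamma> D = sem \<Sigma> B \<Gamma> D"
proof -
  have ty: "\<forall>(x, s) \<in> set \<Gamma>. s \<in> types \<Sigma>" and gr: "\<forall>(x, s) \<in> set \<Gamma>. ground s"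
    and tg: "\<forall>(x, s) \<in> set \<Gamma>. s \<in> types \<Sigma> \<and> ground s"
    and [simp]: "t \<in> types \<Sigma>" "ground t"
    using \<Gamma> t by (auto simp: ground_types_def)
  note ctx [simp] = ctx_obj_transport[OF gr] A.ctx_obj_obj[OF ty]
  note [simp] = A.sem_arr[OF D ty] B.sem_arr[OF D ty, simplified] ty_obj_transport[of t]
  let ?one = "One (cat A)"
  \<comment> \<open>Density concerns maps out of a product with a parameter; the terminal object
    provides a trivial one.\<close>
  let ?p = "Pr2 (cat A) ?one (ctx_obj A \<Gamma>)"
  note sd = sub_diagonal_ctx_rel[OF tg]
  have "\<alpha> (ty_obj A t) \<cdot>\<^bsub>cat A\<^esub> sem \<Sigma> A \<Gamma> D \<cdot>\<^bsub>cat A\<^esub> ?p = sem \<Sigma> B \<Gamma> D \<cdot>\<^bsub>cat A\<^esub> ?p"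
  proof (rule denseD[OF sub_diagonalD(3)[OF sd], where W = ?one])
    fix V j x
    assume [simp]: "j \<in> Arr (cat A)" "Dom (cat A) j = V" "Cod (cat A) j = ?one"
      and x: "ctx_rel \<Gamma> V x x"
    note [simp] = kripkeD(3)[OF sub_diagonalD(1)[OF sd] x]
    show "(\<alpha> (ty_obj A t) \<cdot>\<^bsub>cat A\<^esub> sem \<Sigma> A \<Gamma> D \<cdot>\<^bsub>cat A\<^esub> ?p) \<cdot>\<^bsub>cat A\<^esub> tuple (cat A) j x
      = (sem \<Sigma> B \<Gamma> D \<cdot>\<^bsub>cat A\<^esub> ?p) \<cdot>\<^bsub>cat A\<^esub> tuple (cat A) j x"
      using sem_rel[OF D ty x] by (simp add: lift_rel_ground)
  qed simp_all
  \<comment> \<open>The section of the projection removes the trivial parameter again.\<close>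
  from arg_cong[OF this, of "\<lambda>m. m \<cdot>\<^bsub>cat A\<^esub> tuple (cat A)
      (to_one (cat A) (ctx_obj A \<Gamma>)) (Id (cat A) (ctx_obj A \<Gamma>))"]
  show ?thesis
    by simp
qed

end

theorem theorem4p5:
  fixes \<Sigma> :: "('b, 'k, 'e) signature"
    and A :: "('o, 'm, 'b, 'k, 'e) lc_structure"
    and U :: "('o, 'm) strong_monad"
    and \<alpha> :: "'o \<Rightarrow> 'm"
    and \<Omega>T \<Omega>U :: 'o
    and \<tau>T \<tau>U q Q :: 'm
    and \<Gamma> :: "('v, 'b) ctx"
    and M :: "('v, 'b, 'k, 'e) trm"
    and t :: "'b ty"
    and D :: "('v, 'b, 'k, 'e) deriv"
  assumes "lc_signature \<Sigma>"
    and "lc_structure \<Sigma> A"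
    and "strong_monad (cat A) U"
    and "strong_monad_morphism (cat A) (monad A) U \<alpha>"
    and "em_algebra (cat A) (monad A) \<Omega>T \<tau>T"
    and "em_algebra (cat A) U \<Omega>U \<tau>U"
    and "inference_query (cat A) U \<alpha> \<Omega>T \<tau>T \<Omega>U \<tau>U q"
    and "derives \<Sigma> \<Gamma> D M t"
    and "\<forall>(x, s) \<in> set \<Gamma>. s \<in> ground_types \<Sigma>"
    and "t \<in> ground_types \<Sigma>"
    and "Q \<in> hom (cat A) (ty_obj A t) \<Omega>T"
  shows "q \<cdot>\<^bsub>cat A\<^esub> wp \<Sigma> A \<tau>T \<Gamma> D Q = wp \<Sigma> (transport \<Sigma> U \<alpha> A) \<tau>U \<Gamma> D (q \<cdot>\<^bsub>cat A\<^esub> Q)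
    \<and> q \<cdot>\<^bsub>cat A\<^esub> wp \<Sigma> A \<tau>T \<Gamma> D Q \<in> hom (cat A) (ctx_obj A \<Gamma>) \<Omega>U"
proof -
  interpret strong_monad_morphism "cat A" "monad A" U \<alpha>
    by fact
  interpret lc_transport A U \<alpha> \<Sigma>
    by unfold_locales (fact assms(1,2))+
  interpret OT: em_algebra "cat A" "monad A" \<Omega>T \<tau>T
    by fact
  interpret OU: em_algebra "cat A" U \<Omega>U \<tau>U
    by fact
  have ty: "\<forall>(x, s) \<in> set \<Gamma>. s \<in> types \<Sigma>" and [simp]: "t \<in> types \<Sigma>"
    using assms(9,10) by (auto simp: ground_types_def)
  note [simp] = A.sem_arr[OF assms(8) ty] OT.carrier_obj OU.carrier_obj
  have [simp]: "Q \<in> Arr (cat A)" "Dom (cat A) Q = ty_obj A t" "Cod (cat A) Q = \<Omega>T"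
    "q \<in> Arr (cat A)" "Dom (cat A) q = \<Omega>T" "Cod (cat A) q = \<Omega>U"
    "\<tau>T \<in> Arr (cat A)" "Dom (cat A) \<tau>T = FObj (monad A) \<Omega>T" "Cod (cat A) \<tau>T = \<Omega>T"
    "\<tau>U \<in> Arr (cat A)" "Dom (cat A) \<tau>U = FObj U \<Omega>U" "Cod (cat A) \<tau>U = \<Omega>U"
    using assms(7,11) OT.action_hom OU.action_hom by (auto simp: inference_query_def hom_def)
  let ?s = "sem \<Sigma> A \<Gamma> D"
  have "q \<cdot>\<^bsub>cat A\<^esub> \<tau>T = \<tau>U \<cdot>\<^bsub>cat A\<^esub> FMap U q \<cdot>\<^bsub>cat A\<^esub> \<alpha> \<Omega>T"
    using assms(7) by (simp add: inference_query_def)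
  \<comment> \<open>The query equation is applied before the post-condition and the semantics, which
    brings \<alpha> next to the image of Q.\<close>
  from arg_cong[OF this, of "\<lambda>m. m \<cdot>\<^bsub>cat A\<^esub> FMap (monad A) Q \<cdot>\<^bsub>cat A\<^esub> ?s"]
  have "q \<cdot>\<^bsub>cat A\<^esub> wp \<Sigma> A \<tau>T \<Gamma> D Q
    = \<tau>U \<cdot>\<^bsub>cat A\<^esub> FMap U q \<cdot>\<^bsub>cat A\<^esub> \<alpha> \<Omega>T \<cdot>\<^bsub>cat A\<^esub> FMap (monad A) Q \<cdot>\<^bsub>cat A\<^esub> ?s"
    by (simp add: wp_def)
  \<comment> \<open>Naturality moves \<alpha> past Q onto the semantics, where
    \<open>component_sem\<close> absorbs it; the images of q and Q under U merge.\<close>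
  also have "\<dots> = wp \<Sigma> B \<tau>U \<Gamma> D (q \<cdot>\<^bsub>cat A\<^esub> Q)"
    by (simp add: wp_def component_fmap_comp component_sem[OF assms(8-10), symmetric])
  finally show ?thesis
  proof
    show "q \<cdot>\<^bsub>cat A\<^esub> wp \<Sigma> A \<tau>T \<Gamma> D Q \<in> hom (cat A) (ctx_obj A \<Gamma>) \<Omega>U"
      by (simp add: wp_def hom_def)
  qed
qed

end
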